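(* Equip $\operatorname{Homeo}(\mathbb Q)$ with the topology of pointwise convergence, i.e. the topology generated by the sets $U_{x,y}:=\{f\in\operatorname{Homeo}(\mathbb Q) : (x)f=y\}$ over all $x,y\in\mathbb Q$. Then the topological group $\operatorname{Homeo}(\mathbb Q)$ has: (1) exactly $\aleph_0$ open maximal subgroups; (2) exactly $\mathfrak c$ closed maximal subgroups; (3) exactly $2^{\mathfrak c}$ maximal subgroups.
   Context: $\operatorname{Homeo}(\mathbb Q)$ is the group of all homeomorphisms of $\mathbb Q$ with its usual topology; maps are written on the right. A proper subgroup $M$ of a group $G$ is maximal if there is no subgroup $H$ of $G$ with $M<H<G$. $\mathfrak c=2^{\aleph_0}$. An open (closed) maximal subgroup is a maximal subgroup that is an open (closed) subset in the given topology. *)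

theory Defs
  imports "HOL-Analysis.Analysis" "HOL-Algebra.Group" "HOL-Library.Equipollence"
begin

text \<open>The type \<^typ>\<open>rat\<close> has no topology in the library; its usual topology is the one induced
  by the embedding into the reals.\<close>

definition rat_topology :: "rat topology" where
  "rat_topology = pullback_topology UNIV real_of_rat euclidean"

lemma topspace_rat_topology [simp]: "topspace rat_topology = UNIV"
  by (simp add: rat_topology_def topspace_pullback_topology)

definition homeo_group :: "'a topology \<Rightarrow> ('a \<Rightarrow> 'a) set" where
  "homeo_group X = {f. homeomorphic_map X X f}"

text \<open>Maps act on the right, so the product of \<open>f\<close> and \<open>g\<close> is ``first \<open>f\<close>, then \<open>g\<close>''.\<close>

definition HomeoQ :: "(rat \<Rightarrow> rat) monoid" where
  "HomeoQ = \<lparr>carrier = homeo_group rat_topology, mult = (\<lambda>f g. g \<circ> f), one = id\<rparr>"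

definition basic_nbhd :: "rat \<Rightarrow> rat \<Rightarrow> (rat \<Rightarrow> rat) set" where
  "basic_nbhd x y = {f \<in> carrier HomeoQ. f x = y}"

definition pointwise_topology :: "(rat \<Rightarrow> rat) topology" where
  "pointwise_topology = topology_generated_by {basic_nbhd x y | x y. True}"

definition maximal_subgroup :: "'a set \<Rightarrow> ('a, 'b) monoid_scheme \<Rightarrow> bool" where
  "maximal_subgroup M G \<longleftrightarrow>
     subgroup M G \<and> M \<noteq> carrier G \<and> \<not> (\<exists>H. subgroup H G \<and> M \<subset> H \<and> H \<subset> carrier G)"

lemma HomeoQ_carrier_iff: "f \<in> carrier HomeoQ \<longleftrightarrow> homeomorphic_map rat_topology rat_topology f"
  by (simp add: HomeoQ_def homeo_group_def)

lemma bij_HomeoQ: "f \<in> carrier HomeoQ \<Longrightarrow> bij f"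
  unfolding HomeoQ_carrier_iff
  using homeomorphic_imp_injective_map homeomorphic_imp_surjective_map
  by (metis bij_def topspace_rat_topology)

lemma inv_HomeoQ_closed:
  assumes "f \<in> carrier HomeoQ"
  shows "Hilbert_Choice.inv f \<in> carrier HomeoQ"
proof -
  obtain g where g: "homeomorphic_maps rat_topology rat_topology f g"
    using assms by (auto simp: HomeoQ_carrier_iff homeomorphic_map_maps)
  then have "g = Hilbert_Choice.inv f"
    using inv_unique_comp[of f g] by (auto simp: homeomorphic_maps_def fun_eq_iff)
  moreover have "homeomorphic_map rat_topology rat_topology g"
    using g homeomorphic_maps_map by blast
  ultimately show ?thesis by (simp add: HomeoQ_carrier_iff)
qed

lemma group_HomeoQ: "group HomeoQ"
proof (rule groupI)
  fix f g assume "f \<in> carrier HomeoQ" "g \<in> carrier HomeoQ"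
  then show "f \<otimes>\<^bsub>HomeoQ\<^esub> g \<in> carrier HomeoQ"
    by (auto simp: HomeoQ_def homeo_group_def intro: homeomorphic_map_compose)
next
  fix f assume f: "f \<in> carrier HomeoQ"
  show "\<exists>g\<in>carrier HomeoQ. g \<otimes>\<^bsub>HomeoQ\<^esub> f = \<one>\<^bsub>HomeoQ\<^esub>"
  proof
    show "Hilbert_Choice.inv f \<otimes>\<^bsub>HomeoQ\<^esub> f = \<one>\<^bsub>HomeoQ\<^esub>"
      using bij_HomeoQ[OF f] by (auto simp: HomeoQ_def bij_def surj_iff)
  qed (rule inv_HomeoQ_closed[OF f])
qed (auto simp: HomeoQ_def homeo_group_def comp_assoc)

lemma m_inv_HomeoQ:
  assumes "f \<in> carrier HomeoQ"
  shows "inv\<^bsub>HomeoQ\<^esub> f = Hilbert_Choice.inv f"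
proof (rule group.inv_equality[OF group_HomeoQ _ assms inv_HomeoQ_closed[OF assms]])
  show "Hilbert_Choice.inv f \<otimes>\<^bsub>HomeoQ\<^esub> f = \<one>\<^bsub>HomeoQ\<^esub>"
    using bij_HomeoQ[OF assms] by (auto simp: HomeoQ_def bij_def surj_iff)
qed

lemma topspace_pointwise_topology [simp]: "topspace pointwise_topology = carrier HomeoQ"
  by (auto simp: pointwise_topology_def basic_nbhd_def)

lemma openin_basic_nbhd: "openin pointwise_topology (basic_nbhd x y)"
  unfolding pointwise_topology_def by (rule topology_generated_by_Basis) auto

text \<open>\<^const>\<open>HomeoQ\<close> with \<^const>\<open>pointwise_topology\<close> is a topological group.\<close>

lemma continuous_mult_HomeoQ:
  "continuous_map (prod_topology pointwise_topology pointwise_topology) pointwise_topology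
     (\<lambda>(f, g). f \<otimes>\<^bsub>HomeoQ\<^esub> g)"
proof -
  let ?T = pointwise_topology
  have cl: "f \<otimes>\<^bsub>HomeoQ\<^esub> g \<in> carrier HomeoQ"
    if "f \<in> carrier HomeoQ" "g \<in> carrier HomeoQ" for f g
    using that group_HomeoQ by (simp add: group.is_monoid monoid.m_closed)
  show "continuous_map (prod_topology ?T ?T) ?T (\<lambda>(f, g). f \<otimes>\<^bsub>HomeoQ\<^esub> g)"
    unfolding pointwise_topology_def continuous_on_generated_topo_iff
    unfolding pointwise_topology_def[symmetric]
  proof (intro conjI allI impI)
    fix S assume "S \<in> {basic_nbhd x y |x y. True}"
    then obtain x y where S: "S = basic_nbhd x y" by auto
    have "(\<lambda>(f, g). f \<otimes>\<^bsub>HomeoQ\<^esub> g) -` S \<inter> topspace (prod_topology ?T ?T)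
        = (\<Union>z. basic_nbhd x z \<times> basic_nbhd z y)"
      using cl by (auto simp: S basic_nbhd_def) (auto simp: HomeoQ_def)
    also have "openin (prod_topology ?T ?T) \<dots>"
      by (intro openin_Union) (auto simp: openin_prod_Times_iff openin_basic_nbhd)
    finally show "openin (prod_topology ?T ?T)
      ((\<lambda>(f, g). f \<otimes>\<^bsub>HomeoQ\<^esub> g) -` S \<inter> topspace (prod_topology ?T ?T))" .
  next
    have "\<Union> {basic_nbhd x y |x y. True} = carrier HomeoQ" by (auto simp: basic_nbhd_def)
    then show "(\<lambda>(f, g). f \<otimes>\<^bsub>HomeoQ\<^esub> g) ` topspace (prod_topology ?T ?T) \<subseteq> \<Union> {basic_nbhd x y |x y. True}"
      using cl by auto
  qed
qed

lemma continuous_inv_HomeoQ: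
  "continuous_map pointwise_topology pointwise_topology (\<lambda>f. inv\<^bsub>HomeoQ\<^esub> f)"
proof -
  let ?T = pointwise_topology
  show "continuous_map ?T ?T (\<lambda>f. inv\<^bsub>HomeoQ\<^esub> f)"
    unfolding pointwise_topology_def continuous_on_generated_topo_iff
    unfolding pointwise_topology_def[symmetric]
  proof (intro conjI allI impI)
    fix S assume "S \<in> {basic_nbhd x y |x y. True}"
    then obtain x y where S: "S = basic_nbhd x y" by auto
    have "(\<lambda>f. inv\<^bsub>HomeoQ\<^esub> f) -` S \<inter> topspace ?T = basic_nbhd y x"
      unfolding S basic_nbhd_def using inv_HomeoQ_closed
      by (auto simp: m_inv_HomeoQ bij_HomeoQ inv_f_f bij_is_inj surj_f_inv_f bij_is_surj)
    then show "openin ?T ((\<lambda>f. inv\<^bsub>HomeoQ\<^esub> f) -` S \<inter> topspace ?T)"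
      by (simp add: openin_basic_nbhd)
  next
    have "\<Union> {basic_nbhd x y |x y. True} = carrier HomeoQ" by (auto simp: basic_nbhd_def)
    then show "(\<lambda>f. inv\<^bsub>HomeoQ\<^esub> f) ` topspace ?T \<subseteq> \<Union> {basic_nbhd x y |x y. True}"
      by (auto simp: group.inv_closed[OF group_HomeoQ])
  qed
qed

end

theory Submission
  imports Defs
begin

text \<open>Greedy exhaustion by intervals whose end points are rational translates of rational multiples of
  \<open>sqrt 2\<close>, any two of which are affinely equivalent over the rationals, shows that all
  nonempty open sets of rationals are homeomorphic, so homeomorphisms are easily glued together.

  For an ultrafilter of clopen sets, the group acts doubly transitively on its orbit, so its
  stabilizer is maximal, and different ultrafilters have different stabilizers. An independent family
  of continuum many clopen sets, all of whose boolean combinations with prescribed signs extend to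
  ultrafilters, gives as many maximal subgroups as there are sets of reals. Principal ultrafilters give the
  point stabilizers, which are open. Conversely, the pointwise stabilizers of finite sets \<open>A\<close>
  and \<open>B\<close> generate that of \<open>A \<inter> B\<close>, so an open maximal subgroup containing the
  pointwise stabilizer of a finite set \<open>F\<close> of minimal size is the setwise stabilizer of \<open>F\<close>.

  The stabilizer of a partition of the rationals into two nonempty clopen sets is closed, and it
  is maximal because the homeomorphisms supported in overlapping clopen sets \<open>C\<close> and \<open>D\<close>
  generate those supported in \<open>C \<union> D\<close>. There are continuum many such partitions,
  and no more closed subsets, since the topology is second countable.\<close>

section \<open>Clopen sets of rationals\<close>

abbreviation "G \<equiv> carrier HomeoQ"
abbreviation opq :: "rat set \<Rightarrow> bool" where "opq \<equiv> openin rat_topology"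

definition clopen :: "rat set \<Rightarrow> bool" where "clopen U \<longleftrightarrow> opq U \<and> opq (- U)"

lemma opq_vimage: "open T \<Longrightarrow> opq (real_of_rat -` T)"
  by (auto simp: rat_topology_def openin_pullback_topology)

lemma dist_of_rat: "dist (real_of_rat y) (real_of_rat x) = real_of_rat \<bar>y - x\<bar>"
  by (cases "y \<ge> x") (simp_all add: dist_real_def of_rat_diff of_rat_less_eq abs_if of_rat_less)

lemma opq_iff: "opq U \<longleftrightarrow> (\<forall>x\<in>U. \<exists>e>0. \<forall>y. \<bar>y - x\<bar> < e \<longrightarrow> y \<in> U)"
proof
  assume "opq U"
  then obtain T where T: "open T" "U = real_of_rat -` T"
    by (auto simp: rat_topology_def openin_pullback_topology)
  show "\<forall>x\<in>U. \<exists>e>0. \<forall>y. \<bar>y - x\<bar> < e \<longrightarrow> y \<in> U"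
  proof
    fix x assume "x \<in> U"
    with T obtain e where e: "e > 0" "\<And>y. dist y (real_of_rat x) < e \<Longrightarrow> y \<in> T"
      unfolding open_dist by auto
    obtain d where d: "0 < real_of_rat d" "real_of_rat d < e"
      using of_rat_dense[OF e(1)] by blast
    have "y \<in> U" if "\<bar>y - x\<bar> < d" for y
    proof -
      have "real_of_rat \<bar>y - x\<bar> < real_of_rat d" using that by (simp only: of_rat_less)
      then have "dist (real_of_rat y) (real_of_rat x) < e"
        using d by (simp only: dist_of_rat)
      then show ?thesis using e T by auto
    qed
    then show "\<exists>e>0. \<forall>y. \<bar>y - x\<bar> < e \<longrightarrow> y \<in> U" using d by (metis zero_less_of_rat_iff)
  qed
next
  assume R: "\<forall>x\<in>U. \<exists>e>0. \<forall>y. \<bar>y - x\<bar> < e \<longrightarrow> y \<in> U"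
  have "\<exists>T. opq T \<and> x \<in> T \<and> T \<subseteq> U" if x: "x \<in> U" for x
  proof -
    obtain e where e: "e > 0" "\<And>y. \<bar>y - x\<bar> < e \<Longrightarrow> y \<in> U" using R x by blast
    let ?T = "real_of_rat -` ball (real_of_rat x) (real_of_rat e)"
    have "?T \<subseteq> U"
    proof
      fix y assume "y \<in> ?T"
      then have "real_of_rat \<bar>y - x\<bar> < real_of_rat e"
        by (simp only: vimage_eq mem_ball dist_of_rat abs_minus_commute)
      then show "y \<in> U" using e by (simp only: of_rat_less)
    qed
    then show ?thesis using e by (intro exI[of _ ?T]) (auto intro: opq_vimage)
  qed
  then show "opq U" by (subst openin_subopen) blast
qed

lemma clopen_UNIV [simp]: "clopen UNIV"
  and clopen_empty [simp]: "clopen {}"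
  using openin_topspace[of rat_topology] by (simp_all add: clopen_def)

lemma clopen_Compl: "clopen U \<Longrightarrow> clopen (- U)"
  and clopen_Int: "clopen U \<Longrightarrow> clopen V \<Longrightarrow> clopen (U \<inter> V)"
  and clopen_Un: "clopen U \<Longrightarrow> clopen V \<Longrightarrow> clopen (U \<union> V)"
  and clopen_Diff: "clopen U \<Longrightarrow> clopen V \<Longrightarrow> clopen (U - V)"
  and clopen_opq: "clopen U \<Longrightarrow> opq U"
  by (auto simp: clopen_def Diff_eq)

lemma clopen_Compl_iff [simp]: "clopen (- U) \<longleftrightarrow> clopen U"
  by (auto simp: clopen_def)

section \<open>Clopen sets with irrational boundary points\<close>

lemma of_rat_sq_neq_two: "(x::rat)^2 \<noteq> 2"
proof
  assume x: "x^2 = 2"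
  obtain a b where ab: "quotient_of x = (a, b)" by fastforce
  then have b: "b > 0" "coprime a b" "x = of_int a / of_int b"
    by (auto simp: quotient_of_denom_pos quotient_of_coprime quotient_of_div)
  have "of_int a = x * of_int b" using b by simp
  then have "(of_int a)^2 = 2 * (of_int b :: rat)^2" using x by (simp add: power_mult_distrib)
  then have "of_int (a^2) = (of_int (2 * b^2) :: rat)" by simp
  then have e: "a^2 = 2 * b^2" by (simp only: of_int_eq_iff)
  then have "even a" by (metis dvd_triv_left even_power)
  then obtain k where "a = 2 * k" by blast
  with e have "b^2 = 2 * k^2" by (simp add: power2_eq_square)
  then have "even b" by (metis dvd_triv_left even_power)
  with \<open>even a\<close> b show False by (auto dest: coprime_common_divisor)
qed

lemma sqrt2_neq_rat: "sqrt 2 \<noteq> real_of_rat q"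
proof
  assume "sqrt 2 = real_of_rat q"
  then have "real_of_rat (q^2) = real_of_rat 2"
    by (metis of_rat_power of_rat_numeral_eq real_sqrt_pow2 zero_le_numeral)
  then show False using of_rat_sq_neq_two by (simp only: of_rat_eq_iff)
qed

text \<open>The floor jumps only where \<open>x + sqrt 2\<close> is an integer, which happens at no
  rational \<open>x\<close>, so it is locally constant on the rationals. This turns every set of
  integers into a clopen set.\<close>

lemma clopen_floor: "clopen {x. \<lfloor>real_of_rat x + sqrt 2\<rfloor> \<in> N}"
proof -
  have *: "opq {x. \<lfloor>real_of_rat x + sqrt 2\<rfloor> \<in> N}" for N :: "int set"
  proof -
    have "{x. \<lfloor>real_of_rat x + sqrt 2\<rfloor> \<in> N}
        = real_of_rat -` (\<Union>n\<in>N. {real_of_int n - sqrt 2<..<real_of_int n + 1 - sqrt 2})" (is "?L = ?R")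
    proof (intro subset_antisym subsetI)
      fix x assume x: "x \<in> ?L"
      have "real_of_rat x + sqrt 2 \<noteq> of_int \<lfloor>real_of_rat x + sqrt 2\<rfloor>"
        using sqrt2_neq_rat[of "of_int \<lfloor>real_of_rat x + sqrt 2\<rfloor> - x"] by (auto simp: of_rat_diff)
      with of_int_floor_le[of "real_of_rat x + sqrt 2"] floor_correct[of "real_of_rat x + sqrt 2"]
      show "x \<in> ?R" using x by (intro vimageI2 UN_I[of "\<lfloor>real_of_rat x + sqrt 2\<rfloor>"]) (simp_all, linarith+)
    next
      fix x assume "x \<in> ?R"
      then obtain n where "n \<in> N" "real_of_int n - sqrt 2 < real_of_rat x" "real_of_rat x < real_of_int n + 1 - sqrt 2"
        by auto
      moreover from this have "\<lfloor>real_of_rat x + sqrt 2\<rfloor> = n" by (intro floor_unique) auto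
      ultimately show "x \<in> ?L" by simp
    qed
    then show ?thesis by (simp only:) (intro opq_vimage open_UN ballI open_greaterThanLessThan)
  qed
  have "- {x. \<lfloor>real_of_rat x + sqrt 2\<rfloor> \<in> N} = {x. \<lfloor>real_of_rat x + sqrt 2\<rfloor> \<in> - N}" by auto
  then show ?thesis using * unfolding clopen_def by metis
qed

text \<open>For \<open>r > 0\<close> these are the rationals between \<open>c - r * sqrt 2\<close>
  and \<open>c + r * sqrt 2\<close>; squaring keeps the definition inside the type
  \<open>rat\<close>.\<close>

definition cell :: "rat \<Rightarrow> rat \<Rightarrow> rat set" where
  "cell c r = {x. (x - c)^2 < 2 * r^2}"

text \<open>For nonzero \<open>r\<close> equality never occurs at a rational point because 2 is not
  a rational square, so the complement is also given by a strict inequality of continuous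
  functions.\<close>

lemma clopen_cell: "clopen (cell c r)"
proof (cases "r = 0")
  case True then show ?thesis by (simp add: cell_def)
next
  case False
  have ne: "(x - c)^2 \<noteq> 2 * r^2" for x
    using of_rat_sq_neq_two[of "(x - c) / r"] False by (auto simp: power_divide field_simps)
  have 1: "(x - c)^2 < 2 * r^2 \<longleftrightarrow> (real_of_rat x - of_rat c)^2 < of_rat (2 * r^2)" for x
    by (simp only: of_rat_less[symmetric, where 'a = real] of_rat_diff of_rat_power)
  have "\<not> (x - c)^2 < 2 * r^2 \<longleftrightarrow> 2 * r^2 < (x - c)^2" for x
    using ne[of x] by linarith
  then have 2: "\<not> (x - c)^2 < 2 * r^2 \<longleftrightarrow> (real_of_rat x - of_rat c)^2 > of_rat (2 * r^2)" for x
    by (simp only: of_rat_less[symmetric, where 'a = real] of_rat_diff of_rat_power)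
  have "cell c r = real_of_rat -` {y. (y - of_rat c)^2 < of_rat (2 * r^2)}" 
    unfolding cell_def 1 by auto
  moreover have "- cell c r = real_of_rat -` {y. (y - of_rat c)^2 > of_rat (2 * r^2)}" 
    using 2 unfolding cell_def by auto
  moreover have "open {y::real. (y - of_rat c)^2 < of_rat (2 * r^2)}" "open {y::real. (y - of_rat c)^2 > of_rat (2 * r^2)}"
    by (intro open_Collect_less continuous_intros)+
  ultimately show ?thesis unfolding clopen_def by (simp only: opq_vimage)
qed

lemma center_in_cell: "r > 0 \<Longrightarrow> c \<in> cell c r"
  by (simp add: cell_def)

lemma small_cell:
  assumes "opq U" "x \<in> U"
  obtains r where "r > 0" "cell x r \<subseteq> U"
proof -
  obtain e where e: "e > 0" "\<And>y. \<bar>y - x\<bar> < e \<Longrightarrow> y \<in> U" using assms by (auto simp: opq_iff)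
  \<comment> \<open>The cell of radius parameter \<open>e/2\<close> reaches only as far as
    \<open>e * sqrt 2 / 2 < e\<close>.\<close>
  have "cell x (e/2) \<subseteq> U"
  proof
    fix y assume "y \<in> cell x (e/2)"
    then have "2 * (y - x)^2 < e^2" by (auto simp: cell_def power_divide)
    then have "\<bar>y - x\<bar>^2 < e^2" using zero_le_power2[of "y - x"] unfolding power2_abs by linarith
    then have "\<bar>y - x\<bar> < e" using e power2_less_imp_less by fastforce
    then show "y \<in> U" using e by auto
  qed
  then show ?thesis using that[of "e/2"] e by auto
qed

lemma opq_infinite:
  assumes "opq U" "x \<in> U" shows "infinite U"
proof -
  obtain e where e: "e > 0" "\<And>y. \<bar>y - x\<bar> < e \<Longrightarrow> y \<in> U" using assms by (auto simp: opq_iff)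
  have "{x<..<x+e} \<subseteq> U" using e by auto
  moreover have "infinite {x<..<x+e}" using e by (intro infinite_Ioo) auto
  ultimately show ?thesis using finite_subset by blast
qed

lemma finite_closed: "finite F \<Longrightarrow> opq (- F)"
proof (induction rule: finite_induct)
  case empty
  then show ?case by (metis clopen_UNIV clopen_def Compl_empty_eq)
next
  case (insert x F)
  have "opq (- {x})" unfolding opq_iff by (auto intro!: exI[of _ "\<bar>_ - x\<bar>"])
  then have "opq (- F \<inter> - {x})" using insert by blast
  moreover have "- insert x F = - F \<inter> - {x}" by auto
  ultimately show ?case by simp
qed

lemma small_cell_avoiding:
  assumes "opq U" "x \<in> U" "finite F" "x \<notin> F"
  obtains r where "r > 0" "cell x r \<subseteq> U - F"
proof -
  have "opq (U \<inter> - F)" using assms finite_closed by blast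
  then show ?thesis using small_cell[of "U \<inter> - F" x] assms that by (auto simp: Diff_eq)
qed

lemma small_clopen:
  assumes "opq U" "x \<in> U" "finite F" "x \<notin> F"
  obtains V where "clopen V" "x \<in> V" "V \<subseteq> U - F"
  using small_cell_avoiding[OF assms] clopen_cell center_in_cell by metis

section \<open>Gluing homeomorphisms\<close>

text \<open>For open \<open>U\<close> and \<open>V\<close> this says that \<open>f\<close> restricts
  to a homeomorphism between the subspaces: there, relative openness is openness in the whole space.
  Values of \<open>f\<close> outside \<open>U\<close> do not matter.\<close>

definition homeo_betw :: "rat set \<Rightarrow> rat set \<Rightarrow> (rat \<Rightarrow> rat) \<Rightarrow> bool" where
  "homeo_betw U V f \<longleftrightarrow> bij_betw f U V \<and> (\<forall>W\<subseteq>U. opq (f ` W) \<longleftrightarrow> opq W)"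

lemma G_iff_homeo_betw: "f \<in> G \<longleftrightarrow> homeo_betw UNIV UNIV f"
proof
  assume f: "f \<in> G"
  then have "homeomorphic_map rat_topology rat_topology f" by (simp add: HomeoQ_carrier_iff)
  then have "opq (f ` W) \<longleftrightarrow> opq W" for W
    using homeomorphic_map_openness by fastforce
  then show "homeo_betw UNIV UNIV f" using bij_HomeoQ[OF f] by (simp add: homeo_betw_def)
next
  assume f: "homeo_betw UNIV UNIV f"
  then have b: "bij f" and o: "\<And>W. opq (f ` W) \<longleftrightarrow> opq W" by (auto simp: homeo_betw_def)
  have "opq (f -` W)" if "opq W" for W
    using o[of "f -` W"] b that by (simp add: surj_image_vimage_eq bij_is_surj)
  then have "continuous_map rat_topology rat_topology f"
    by (auto simp: continuous_map_def vimage_def)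
  then show "f \<in> G"
    unfolding HomeoQ_carrier_iff using b o
    by (intro bijective_open_imp_homeomorphic_map) (auto simp: open_map_def bij_def)
qed

lemma opq_image_G: "f \<in> G \<Longrightarrow> opq (f ` W) \<longleftrightarrow> opq W"
  by (simp add: G_iff_homeo_betw homeo_betw_def)

lemma clopen_image_G: "f \<in> G \<Longrightarrow> clopen (f ` W) \<longleftrightarrow> clopen W"
  using bij_image_Compl_eq[OF bij_HomeoQ, of f W] opq_image_G[of f W] opq_image_G[of f "- W"]
  by (simp add: clopen_def)

lemma homeo_betw_image: "homeo_betw U V f \<Longrightarrow> f ` U = V"
  by (simp add: homeo_betw_def bij_betw_imp_surj_on)

lemma homeo_betw_cong: "(\<And>x. x \<in> U \<Longrightarrow> f x = g x) \<Longrightarrow> homeo_betw U V f \<longleftrightarrow> homeo_betw U V g"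
proof -
  assume e: "\<And>x. x \<in> U \<Longrightarrow> f x = g x"
  then have "W \<subseteq> U \<Longrightarrow> f ` W = g ` W" for W by (auto intro!: image_cong)
  with e show ?thesis unfolding homeo_betw_def by (metis bij_betw_cong)
qed

lemma homeo_betw_id: "homeo_betw U U (\<lambda>x. x)"
  by (simp add: homeo_betw_def bij_betw_def)

lemma homeo_betw_restrict:
  assumes "homeo_betw U V f" "W \<subseteq> U" shows "homeo_betw W (f ` W) f"
proof -
  have "inj_on f W" using assms inj_on_subset unfolding homeo_betw_def bij_betw_def by blast
  then show ?thesis using assms unfolding homeo_betw_def bij_betw_def by simp
qed

lemma homeo_betw_inv: "homeo_betw U V f \<Longrightarrow> homeo_betw V U (inv_into U f)"
proof -
  assume f: "homeo_betw U V f"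
  then have b: "bij_betw f U V" by (simp add: homeo_betw_def)
  have "opq (inv_into U f ` W) \<longleftrightarrow> opq W" if "W \<subseteq> V" for W
  proof -
    have "inv_into U f ` W \<subseteq> U" using b that by (metis bij_betw_imp_surj_on bij_betw_inv_into image_mono)
    moreover have "f ` inv_into U f ` W = W" using b that by (simp add: bij_betw_def image_inv_into_cancel)
    ultimately show ?thesis using f unfolding homeo_betw_def by metis
  qed
  then show ?thesis using b by (simp add: homeo_betw_def bij_betw_inv_into)
qed

text \<open>Disjoint targets make the glued map injective, and since all pieces are open, openness
  of a set can be tested piece by piece on either side.\<close>

lemma homeo_betw_UN:
  assumes "disjoint_family_on V I"
    and "\<And>i. i \<in> I \<Longrightarrow> opq (U i)" "\<And>i. i \<in> I \<Longrightarrow> opq (V i)"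
    and f: "\<And>i. i \<in> I \<Longrightarrow> homeo_betw (U i) (V i) f"
  shows "homeo_betw (\<Union>i\<in>I. U i) (\<Union>i\<in>I. V i) f"
  unfolding homeo_betw_def
proof (intro conjI allI impI)
  show "bij_betw f (\<Union>i\<in>I. U i) (\<Union>i\<in>I. V i)"
    using assms by (intro bij_betw_UNION_disjoint) (auto simp: homeo_betw_def)
  fix W assume W: "W \<subseteq> (\<Union>i\<in>I. U i)"
  have img: "f ` U i = V i" if "i \<in> I" for i using f[OF that] by (rule homeo_betw_image)
  have inj: "inj_on f (\<Union>i\<in>I. U i)" 
    using \<open>bij_betw f _ _\<close> by (rule bij_betw_imp_inj_on)
  have fW: "f ` (W \<inter> U i) = f ` W \<inter> V i" if "i \<in> I" for i
  proof -
    have "f ` (W \<inter> U i) = f ` W \<inter> f ` U i"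
      using W that by (intro inj_on_image_Int[OF inj]) auto
    then show ?thesis using img[OF that] by simp
  qed
  have 1: "W = (\<Union>i\<in>I. W \<inter> U i)" and 2: "f ` W = (\<Union>i\<in>I. f ` (W \<inter> U i))" using W by blast+
  show "opq (f ` W) \<longleftrightarrow> opq W"
  proof
    assume "opq W"
    then have "opq (f ` (W \<inter> U i))" if "i \<in> I" for i
      using f[OF that] assms(2)[OF that] unfolding homeo_betw_def by auto
    then show "opq (f ` W)" by (subst 2) auto
  next
    assume "opq (f ` W)"
    then have "opq (f ` (W \<inter> U i))" if "i \<in> I" for i
      using fW[OF that] assms(3)[OF that] by auto
    then have "opq (W \<inter> U i)" if "i \<in> I" for i
      using f[OF that] that unfolding homeo_betw_def by auto
    then have "opq (\<Union>i\<in>I. W \<inter> U i)" by (intro openin_Union) auto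
    then show "opq W" by (simp only: flip: 1)
  qed
qed

text \<open>Pieces may be empty, so three of them cover all later uses: a map, a second map or the
  inverse of the first, and the identity on the rest.\<close>

lemma glue3:
  assumes "homeo_betw U1 V1 f1" "homeo_betw U2 V2 f2" "homeo_betw U3 V3 f3"
    and "opq U1" "opq U2" "opq U3" "opq V1" "opq V2" "opq V3"
    and "U1 \<union> U2 \<union> U3 = UNIV" "V1 \<union> V2 \<union> V3 = UNIV"
    and "U1 \<inter> U2 = {}" "U1 \<inter> U3 = {}" "U2 \<inter> U3 = {}"
    and "V1 \<inter> V2 = {}" "V1 \<inter> V3 = {}" "V2 \<inter> V3 = {}"
  obtains k where "k \<in> G" "\<And>x. x \<in> U1 \<Longrightarrow> k x = f1 x" "\<And>x. x \<in> U2 \<Longrightarrow> k x = f2 x"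
    "\<And>x. x \<in> U3 \<Longrightarrow> k x = f3 x"
proof -
  define k where "k x = (if x \<in> U1 then f1 x else if x \<in> U2 then f2 x else f3 x)" for x
  have e: "\<And>x. x \<in> U1 \<Longrightarrow> k x = f1 x" "\<And>x. x \<in> U2 \<Longrightarrow> k x = f2 x" "\<And>x. x \<in> U3 \<Longrightarrow> k x = f3 x"
    using assms by (auto simp: k_def)
  have p: "homeo_betw U1 V1 k" "homeo_betw U2 V2 k" "homeo_betw U3 V3 k"
    using assms(1,2,3) e homeo_betw_cong by blast+
  define U where "U i = (if i = (0::nat) then U1 else if i = 1 then U2 else U3)" for i
  define V where "V i = (if i = (0::nat) then V1 else if i = 1 then V2 else V3)" for i
  have "homeo_betw (\<Union>i\<in>{0,1,2}. U i) (\<Union>i\<in>{0,1,2}. V i) k"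
  proof (rule homeo_betw_UN)
    show "disjoint_family_on V {0,1,2}" using assms by (auto simp: disjoint_family_on_def V_def)
  qed (use p assms in \<open>auto simp: U_def V_def\<close>)
  moreover have "(\<Union>i\<in>{0,1,2}. U i) = UNIV" "(\<Union>i\<in>{0,1,2}. V i) = UNIV"
    using assms by (auto simp: U_def V_def)
  ultimately have "k \<in> G" by (simp add: G_iff_homeo_betw)
  then show ?thesis using that e by blast
qed

section \<open>Homeomorphisms between nonempty open sets\<close>

lemma opq_affine:
  assumes "a \<noteq> 0" "opq W" shows "opq ((\<lambda>x. a * x + b) ` W)"
  unfolding opq_iff
proof clarify
  fix x assume "x \<in> W"
  then obtain e where e: "e > 0" "\<And>y. \<bar>y - x\<bar> < e \<Longrightarrow> y \<in> W" using assms by (auto simp: opq_iff)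
  show "\<exists>e>0. \<forall>y. \<bar>y - (a * x + b)\<bar> < e \<longrightarrow> y \<in> (\<lambda>x. a * x + b) ` W"
  proof (intro exI[of _ "\<bar>a\<bar> * e"] conjI allI impI)
    show "\<bar>a\<bar> * e > 0" using assms e by simp
    fix y assume y: "\<bar>y - (a * x + b)\<bar> < \<bar>a\<bar> * e"
    have "\<bar>a\<bar> * \<bar>(y - b) / a - x\<bar> = \<bar>y - (a * x + b)\<bar>"
    proof -
      have "a * ((y - b) / a - x) = y - (a * x + b)" using assms by (simp add: field_simps)
      then show ?thesis by (metis abs_mult)
    qed
    then have "\<bar>(y - b) / a - x\<bar> < e" using y assms by (metis mult_less_cancel_left_pos zero_less_abs_iff)
    then have "(y - b) / a \<in> W" using e by blast
    then show "y \<in> (\<lambda>x. a * x + b) ` W" using assms by (auto intro!: image_eqI[of _ _ "(y-b)/a"])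
  qed
qed

lemma homeo_betw_affine:
  assumes "a \<noteq> 0" shows "homeo_betw UNIV UNIV (\<lambda>x. a * x + b)"
proof -
  have inv: "(\<lambda>x. inverse a * x + (- b / a)) ` (\<lambda>x. a * x + b) ` W = W" for W
    using assms by (auto simp: image_image field_simps)
  have "bij (\<lambda>x. a * x + b)"
    by (rule o_bij[of "\<lambda>x. inverse a * x + (- b / a)"]) (use assms in \<open>auto simp: fun_eq_iff field_simps\<close>)
  moreover have "opq ((\<lambda>x. a * x + b) ` W) \<longleftrightarrow> opq W" for W
    using opq_affine[OF assms] opq_affine[of "inverse a" "(\<lambda>x. a * x + b) ` W" "- b / a"] assms
    unfolding inv by auto
  ultimately show ?thesis by (simp add: homeo_betw_def)
qed

text \<open>The rational affine map taking centre to centre with slope \<open>s / r\<close> takes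
  the end points \<open>c - r * sqrt 2\<close> and \<open>c + r * sqrt 2\<close> to those of the
  other cell.\<close>

lemma homeo_betw_cells:
  assumes "r > 0" "s > 0"
  shows "homeo_betw (cell c r) (cell d s) (\<lambda>x. (s / r) * x + (d - s / r * c))"
proof -
  let ?f = "\<lambda>x. (s / r) * x + (d - s / r * c)"
  have m: "?f x \<in> cell d s \<longleftrightarrow> x \<in> cell c r" for x
  proof -
    have "?f x - d = (s / r) * (x - c)" using assms by (simp add: field_simps)
    then have "(?f x - d)^2 = (s^2 / r^2) * (x - c)^2" by (simp add: power_mult_distrib power_divide)
    moreover have "(s^2 / r^2) * (x - c)^2 < 2 * s^2 \<longleftrightarrow> (s^2 / r^2) * (x - c)^2 < (s^2 / r^2) * (2 * r^2)"
      using assms by (simp add: mult.commute)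
    moreover have "\<dots> \<longleftrightarrow> (x - c)^2 < 2 * r^2" using assms by (intro mult_less_cancel_left_pos) simp
    ultimately show ?thesis by (simp add: cell_def)
  qed
  have p: "homeo_betw UNIV UNIV ?f" using assms by (intro homeo_betw_affine) simp
  have "?f ` cell c r = cell d s"
  proof (intro subset_antisym subsetI)
    fix y assume y: "y \<in> cell d s"
    have "y \<in> range ?f" using homeo_betw_image[OF p] by simp
    then obtain x where "y = ?f x" by (rule rangeE)
    then show "y \<in> ?f ` cell c r" using y m by blast
  qed (use m in blast)
  then show ?thesis using homeo_betw_restrict[OF p, of "cell c r"] by simp
qed

text \<open>The cells are chosen greedily: each one is centred at the first uncovered point of a fixed
  enumeration of the rationals, which makes them cover, and leaves some point uncovered, which
  makes the process go on forever.\<close>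

lemma cell_partition:
  assumes "opq U" "U \<noteq> {}"
  obtains c r where "\<And>n::nat. r n > 0" "disjoint_family (\<lambda>n. cell (c n) (r n))"
    "(\<Union>n. cell (c n) (r n)) = U"
proof -
  define idx where "idx W = (LEAST n. from_nat n \<in> W)" for W :: "rat set"
  define cen :: "rat set \<Rightarrow> rat" where "cen W = from_nat (idx W)" for W
  have cen: "cen W \<in> W" if "W \<noteq> {}" for W
  proof -
    obtain x where "x \<in> W" using \<open>W \<noteq> {}\<close> by blast
    then have "from_nat (to_nat x) \<in> W" by simp
    then show ?thesis unfolding cen_def idx_def by (rule LeastI)
  qed
  have "\<exists>r. opq W \<and> W \<noteq> {} \<longrightarrow> r > 0 \<and> cell (cen W) r \<subset> W" for W
  proof (cases "opq W \<and> W \<noteq> {}")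
    case True
    then have "infinite W" using opq_infinite by blast
    then obtain y where y: "y \<in> W" "y \<noteq> cen W" by (metis finite.simps infinite_imp_nonempty insertCI subsetI subset_singletonD)
    obtain r where "r > 0" "cell (cen W) r \<subseteq> W - {y}"
      using small_cell_avoiding[of W "cen W" "{y}"] True cen y by auto
    then show ?thesis using y by blast
  qed auto
  then obtain rad where rad: "\<And>W. opq W \<Longrightarrow> W \<noteq> {} \<Longrightarrow> rad W > 0 \<and> cell (cen W) (rad W) \<subset> W"
    by metis
  define W where "W n = ((\<lambda>W. W - cell (cen W) (rad W)) ^^ n) U" for n
  have W0: "W 0 = U" and WS: "W (Suc n) = W n - cell (cen (W n)) (rad (W n))" for n
    by (simp_all add: W_def)
  have W: "opq (W n) \<and> W n \<noteq> {}" for n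
  proof (induction n)
    case (Suc n)
    then have "opq (W n \<inter> - cell (cen (W n)) (rad (W n)))"
      using clopen_cell unfolding clopen_def by blast
    then show ?case using rad[of "W n"] Suc by (auto simp: WS Diff_eq)
  qed (use assms W0 in auto)
  define C where "C n = cell (cen (W n)) (rad (W n))" for n
  have C: "rad (W n) > 0" "C n \<subseteq> W n" "cen (W n) \<in> C n" for n
    using rad[of "W n"] W[of n] by (auto simp: C_def center_in_cell)
  have mono: "W n \<subseteq> W m" if "m \<le> n" for m n
    using lift_Suc_antimono_le[of W] WS that by blast
  have disj: "C m \<inter> C n = {}" if "m < n" for m n
    using mono[of "Suc m" n] C(2)[of n] that by (auto simp: WS C_def)
  have "disjoint_family C"
    unfolding disjoint_family_on_def using disj by (metis Int_commute linorder_less_linear)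
  moreover have "(\<Union>n. C n) = U"
  proof (intro subset_antisym subsetI)
    fix x assume "x \<in> (\<Union>n. C n)"
    then show "x \<in> U" using C(2) mono[of 0] W0 by blast
  next
    fix x assume x: "x \<in> U"
    show "x \<in> (\<Union>n. C n)"
    proof (rule ccontr)
      assume n: "x \<notin> (\<Union>n. C n)"
      have xW: "x \<in> W n" for n by (induction n) (use x n in \<open>auto simp: W0 WS C_def\<close>)
      \<comment> \<open>A point that is never covered bounds the indices of all centres, yet these
        indices strictly increase.\<close>
      have le: "idx (W n) \<le> to_nat x" for n
        unfolding idx_def by (rule Least_le) (simp add: xW)
      have lt: "idx (W n) < idx (W (Suc n))" for n
      proof -
        have a: "cen (W (Suc n)) \<in> W (Suc n)" using cen W by blast
        then have "idx (W n) \<le> idx (W (Suc n))"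
          unfolding idx_def[of "W n"] by (intro Least_le) (use mono[of n "Suc n"] in \<open>auto simp: cen_def\<close>)
        moreover have "idx (W n) \<noteq> idx (W (Suc n))"
          using a C(3)[of n] unfolding WS C_def cen_def by auto
        ultimately show ?thesis by simp
      qed
      have "n \<le> idx (W n)" for n
      proof (induction n)
        case (Suc n)
        then show ?case using lt[of n] by linarith
      qed simp
      from this[of "Suc (to_nat x)"] le[of "Suc (to_nat x)"] show False by simp
    qed
  qed
  ultimately show ?thesis
    unfolding C_def[abs_def] by (rule that[rotated]) (rule C(1))
qed

text \<open>Both sets split into cells indexed by all natural numbers, so the \<open>n\<close>-th
  cell of one can be mapped affinely onto the \<open>n\<close>-th cell of the other.\<close>

lemma homeo_betw_exists:
  assumes "opq U" "U \<noteq> {}" "opq V" "V \<noteq> {}"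
  obtains f where "homeo_betw U V f"
proof -
  obtain c r where c: "\<And>n::nat. r n > 0" "disjoint_family (\<lambda>n. cell (c n) (r n))" "(\<Union>n. cell (c n) (r n)) = U"
    using cell_partition assms by metis
  obtain d s where d: "\<And>n::nat. s n > 0" "disjoint_family (\<lambda>n. cell (d n) (s n))" "(\<Union>n. cell (d n) (s n)) = V"
    using cell_partition assms by metis
  define f where "f x = (let n = (THE n. x \<in> cell (c n) (r n)) in (s n / r n) * x + (d n - s n / r n * c n))" for x
  have the: "(THE n. x \<in> cell (c n) (r n)) = n" if "x \<in> cell (c n) (r n)" for x n
    using c(2) that by (intro the_equality) (auto simp: disjoint_family_on_def)
  have "homeo_betw (cell (c n) (r n)) (cell (d n) (s n)) f" for n
  proof -
    have "homeo_betw (cell (c n) (r n)) (cell (d n) (s n)) f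
      \<longleftrightarrow> homeo_betw (cell (c n) (r n)) (cell (d n) (s n)) (\<lambda>x. (s n / r n) * x + (d n - s n / r n * c n))"
      by (rule homeo_betw_cong) (simp add: f_def the)
    then show ?thesis using homeo_betw_cells c(1) d(1) by blast
  qed
  then have "homeo_betw (\<Union>n. cell (c n) (r n)) (\<Union>n. cell (d n) (s n)) f"
    using d(2) clopen_cell clopen_opq by (intro homeo_betw_UN) auto
  then show ?thesis using that c d by simp
qed

section \<open>Homeomorphisms moving prescribed sets and points\<close>

lemma swap:
  assumes "clopen U" "clopen V" "U \<inter> V = {}" "homeo_betw U V g"
  obtains s where "s \<in> G" "s ` U = V" "s ` V = U" "\<And>x. x \<in> U \<Longrightarrow> s x = g x"
    "\<And>x. x \<notin> U \<Longrightarrow> x \<notin> V \<Longrightarrow> s x = x"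
proof -
  have o: "opq U" "opq V" "opq (- (U \<union> V))"
    using assms clopen_opq clopen_Compl clopen_Un by auto
  \<comment> \<open>An involution: \<open>g\<close> on \<open>U\<close>, its inverse on
    \<open>V\<close>, the identity elsewhere.\<close>
  obtain s where s: "s \<in> G" "\<And>x. x \<in> U \<Longrightarrow> s x = g x" "\<And>x. x \<in> V \<Longrightarrow> s x = inv_into U g x"
    "\<And>x. x \<in> - (U \<union> V) \<Longrightarrow> s x = x"
    by (rule glue3[OF assms(4) homeo_betw_inv[OF assms(4)] homeo_betw_id[of "- (U \<union> V)"]]) (use assms o in auto)
  have "s ` U = g ` U" "s ` V = inv_into U g ` V" using s by (auto intro!: image_cong)
  then have i: "s ` U = V" "s ` V = U" using homeo_betw_image[OF assms(4)] homeo_betw_image[OF homeo_betw_inv[OF assms(4)]] by auto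
  show ?thesis by (rule that[of s]) (use s i in auto)
qed

lemma swap_sets:
  assumes "clopen U" "clopen V" "U \<inter> V = {}" "U \<noteq> {}" "V \<noteq> {}"
  obtains s where "s \<in> G" "s ` U = V" "s ` V = U" "\<And>x. x \<notin> U \<Longrightarrow> x \<notin> V \<Longrightarrow> s x = x"
proof -
  obtain g where "homeo_betw U V g" using homeo_betw_exists assms clopen_opq by metis
  then show ?thesis using swap[OF assms(1-3)] that by metis
qed

text \<open>Proper inclusion makes \<open>D - T\<close> and \<open>D - T'\<close> nonempty as well,
  hence homeomorphic, so a homeomorphism from \<open>T\<close> to \<open>T'\<close> extends over
  \<open>D\<close>.\<close>

lemma move_within:
  assumes "clopen D" "clopen T" "clopen T'" "T \<subset> D" "T' \<subset> D" "T \<noteq> {}" "T' \<noteq> {}"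
  obtains k where "k \<in> G" "k ` T = T'" "\<And>x. x \<notin> D \<Longrightarrow> k x = x"
proof -
  obtain f where f: "homeo_betw T T' f" using homeo_betw_exists assms clopen_opq by metis
  have o: "opq (D - T)" "opq (D - T')" "opq (- D)" "opq T" "opq T'" using assms clopen_Diff clopen_opq clopen_Compl by auto
  moreover have "D - T \<noteq> {}" "D - T' \<noteq> {}" using assms by auto
  ultimately obtain g where g: "homeo_betw (D - T) (D - T') g" using homeo_betw_exists by metis
  obtain k where k: "k \<in> G" "\<And>x. x \<in> T \<Longrightarrow> k x = f x" "\<And>x. x \<in> - D \<Longrightarrow> k x = x"
    by (rule glue3[OF f g homeo_betw_id[of "- D"]]) (use assms o in auto)
  have "k ` T = f ` T" using k by (auto intro!: image_cong)
  then show ?thesis using that k homeo_betw_image[OF f] by auto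
qed

text \<open>Disjoint small cells around \<open>x\<close> and \<open>y\<close> that avoid
  \<open>F\<close> are swapped by an affine map, which matches their centres.\<close>

lemma swap_points:
  assumes "x \<noteq> y" "finite F" "x \<notin> F" "y \<notin> F" "opq U" "x \<in> U" "y \<in> U"
  obtains s where "s \<in> G" "s x = y" "\<And>z. z \<in> F \<Longrightarrow> s z = z" "\<And>z. z \<notin> U \<Longrightarrow> s z = z"
proof -
  obtain r where r: "r > 0" "cell x r \<subseteq> U - insert y F"
    using small_cell_avoiding[of U x "insert y F"] assms by auto
  have "opq (U \<inter> - cell x r)" using assms clopen_cell unfolding clopen_def by blast
  then obtain t where t: "t > 0" "cell y t \<subseteq> U \<inter> - cell x r - F"
    using small_cell_avoiding[of "U \<inter> - cell x r" y F] assms r by auto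
  obtain s where s: "s \<in> G" "\<And>z. z \<in> cell x r \<Longrightarrow> s z = (t / r) * z + (y - t / r * x)"
    "\<And>z. z \<notin> cell x r \<Longrightarrow> z \<notin> cell y t \<Longrightarrow> s z = z"
    by (rule swap[OF clopen_cell clopen_cell _ homeo_betw_cells[OF r(1) t(1)]]) (use t in auto)
  have "s x = y" using s(2) center_in_cell r by simp
  then show ?thesis using that s r t by blast
qed

section \<open>Ultrafilters of clopen sets\<close>

lemma subgroup_HomeoQ_iff:
  "subgroup H HomeoQ \<longleftrightarrow> H \<subseteq> G \<and> id \<in> H \<and> (\<forall>f\<in>H. \<forall>g\<in>H. g \<circ> f \<in> H)
     \<and> (\<forall>f\<in>H. Hilbert_Choice.inv f \<in> H)"
proof -
  have 1: "\<one>\<^bsub>HomeoQ\<^esub> = id" "f \<otimes>\<^bsub>HomeoQ\<^esub> g = g \<circ> f" for f g by (simp_all add: HomeoQ_def)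
  have 2: "inv\<^bsub>HomeoQ\<^esub> f = Hilbert_Choice.inv f" if "H \<subseteq> G" "f \<in> H" for f
    using that m_inv_HomeoQ by blast
  show ?thesis
    using 2 unfolding subgroup_def 1 by (metis (no_types, lifting))
qed

lemma G_subgroup: "subgroup G HomeoQ"
  using group.subgroup_self[OF group_HomeoQ] .

lemma G_comp: "f \<in> G \<Longrightarrow> g \<in> G \<Longrightarrow> g \<circ> f \<in> G"
  and G_inv: "f \<in> G \<Longrightarrow> Hilbert_Choice.inv f \<in> G"
  and G_id: "id \<in> G"
  using G_subgroup unfolding subgroup_HomeoQ_iff by blast+

lemma sub_comp: "subgroup H HomeoQ \<Longrightarrow> f \<in> H \<Longrightarrow> g \<in> H \<Longrightarrow> g \<circ> f \<in> H"
  and sub_inv: "subgroup H HomeoQ \<Longrightarrow> f \<in> H \<Longrightarrow> Hilbert_Choice.inv f \<in> H"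
  and sub_G: "subgroup H HomeoQ \<Longrightarrow> H \<subseteq> G"
  and sub_id: "subgroup H HomeoQ \<Longrightarrow> id \<in> H"
  unfolding subgroup_HomeoQ_iff by blast+

text \<open>The recurring way to place \<open>f\<close> in a subgroup: correct it by a known element
  until the product is recognized.\<close>

lemma sub_cancel_left:
  assumes "subgroup H HomeoQ" "g \<in> H" "g \<circ> f \<in> H"
  shows "f \<in> H"
proof -
  have "inj g" using assms sub_G bij_HomeoQ bij_is_inj by blast
  then have "Hilbert_Choice.inv g \<circ> (g \<circ> f) = f" by (simp add: comp_assoc[symmetric] inj_iff)
  then show ?thesis using sub_comp[OF assms(1,3) sub_inv[OF assms(1,2)]] by simp
qed

lemma maximal_subgroupI:
  assumes "subgroup M HomeoQ" "M \<noteq> G"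
    and "\<And>H h f. subgroup H HomeoQ \<Longrightarrow> M \<subseteq> H \<Longrightarrow> h \<in> H \<Longrightarrow> h \<notin> M \<Longrightarrow> f \<in> G \<Longrightarrow> f \<in> H"
  shows "maximal_subgroup M HomeoQ"
  unfolding maximal_subgroup_def using assms by blast

lemma maximal_subgroup_eq:
  assumes "maximal_subgroup M HomeoQ" "subgroup H HomeoQ" "M \<subseteq> H" "H \<noteq> G"
  shows "M = H"
  using assms sub_G[OF assms(2)] unfolding maximal_subgroup_def by blast

text \<open>Arbitrary families are allowed so that the definition serves both for ultrafilters and
  for partitions \<open>{A, - A}\<close>.\<close>

definition stab :: "rat set set \<Rightarrow> (rat \<Rightarrow> rat) set" where
  "stab p = {f \<in> G. (`) f ` p = p}"

lemma image_image_comp: "(`) (g \<circ> f) ` p = (`) g ` (`) f ` p"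
  by (auto simp: image_comp)

lemma image_image_inv: "bij f \<Longrightarrow> (`) (Hilbert_Choice.inv f) ` (`) f ` p = p"
  by (simp add: image_comp[symmetric] image_image bij_is_inj image_inv_f_f)

lemma stab_subgroup: "subgroup (stab p) HomeoQ"
  unfolding subgroup_HomeoQ_iff
proof (intro conjI ballI)
  show "stab p \<subseteq> G" by (auto simp: stab_def)
  show "id \<in> stab p" by (auto simp: stab_def G_id)
  fix f assume f: "f \<in> stab p"
  then show "g \<circ> f \<in> stab p" if "g \<in> stab p" for g
    using that unfolding stab_def mem_Collect_eq image_image_comp by (simp add: G_comp)
  show "Hilbert_Choice.inv f \<in> stab p"
    using f image_image_inv[of f p] by (simp add: stab_def G_inv bij_HomeoQ)
qed

text \<open>The points of the Stone space of the algebra of clopen sets. The finite intersection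
  property together with deciding every clopen set yields the filter laws \<open>ult_Int\<close> and
  \<open>ult_mono\<close>.\<close>

definition clopen_ultrafilter :: "rat set set \<Rightarrow> bool" where
  "clopen_ultrafilter p \<longleftrightarrow> (\<forall>A\<in>p. clopen A) \<and> (\<forall>S\<subseteq>p. finite S \<longrightarrow> \<Inter>S \<noteq> {}) \<and> (\<forall>A. clopen A \<longrightarrow> A \<in> p \<or> - A \<in> p)"

lemma ult_clopen: "clopen_ultrafilter p \<Longrightarrow> A \<in> p \<Longrightarrow> clopen A"
  by (simp add: clopen_ultrafilter_def)

lemma ult_meet3: "clopen_ultrafilter p \<Longrightarrow> A \<in> p \<Longrightarrow> B \<in> p \<Longrightarrow> C \<in> p \<Longrightarrow> A \<inter> B \<inter> C \<noteq> {}"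
proof -
  assume "clopen_ultrafilter p" "A \<in> p" "B \<in> p" "C \<in> p"
  then have "\<Inter>{A, B, C} \<noteq> {}" unfolding clopen_ultrafilter_def by (metis empty_subsetI finite.simps insert_subset)
  then show ?thesis by (simp add: Int_assoc)
qed

lemma ult_Compl: "clopen_ultrafilter p \<Longrightarrow> clopen A \<Longrightarrow> - A \<in> p \<longleftrightarrow> A \<notin> p"
  using ult_meet3[of p A "- A" A] unfolding clopen_ultrafilter_def by auto

lemma ult_Int: "clopen_ultrafilter p \<Longrightarrow> A \<in> p \<Longrightarrow> B \<in> p \<Longrightarrow> A \<inter> B \<in> p"
  using ult_meet3[of p A B "- (A \<inter> B)"] ult_Compl[of p "A \<inter> B"] ult_clopen[of p] clopen_Int[of A B]
  by auto

lemma ult_mono: "clopen_ultrafilter p \<Longrightarrow> A \<in> p \<Longrightarrow> A \<subseteq> B \<Longrightarrow> clopen B \<Longrightarrow> B \<in> p"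
  using ult_meet3[of p A "- B" A] ult_Compl[of p B] by blast

text \<open>A member of \<open>q\<close> missing from \<open>p\<close> would have its complement in
  \<open>p\<close>, hence also in \<open>q\<close>.\<close>

lemma ult_eq: "clopen_ultrafilter p \<Longrightarrow> clopen_ultrafilter q \<Longrightarrow> p \<subseteq> q \<Longrightarrow> p = q"
  using ult_Compl ult_clopen by blast

lemma ult_separate:
  assumes "clopen_ultrafilter p" "clopen_ultrafilter q" "p \<noteq> q"
  obtains A where "clopen A" "A \<in> p" "- A \<in> q"
proof -
  have "\<not> p \<subseteq> q" using ult_eq assms by blast
  then obtain A where "A \<in> p" "A \<notin> q" by blast
  then show ?thesis using that ult_clopen[OF assms(1)] ult_Compl[OF assms(2)] by simp
qed

lemma ult_image:
  assumes "clopen_ultrafilter p" "f \<in> G" shows "clopen_ultrafilter ((`) f ` p)"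
  unfolding clopen_ultrafilter_def
proof (intro conjI ballI allI impI)
  fix A assume "A \<in> (`) f ` p" then show "clopen A" using assms clopen_image_G ult_clopen by blast
next
  fix S assume "S \<subseteq> (`) f ` p" "finite S"
  then obtain T where T: "T \<subseteq> p" "finite T" "S = (`) f ` T" by (meson finite_subset_image)
  then obtain x where "x \<in> \<Inter>T" using assms(1) unfolding clopen_ultrafilter_def by blast
  then have "f x \<in> \<Inter>S" using T by blast
  then show "\<Inter>S \<noteq> {}" by blast
next
  fix A :: "rat set" assume A: "clopen A"
  have b: "bij f" using assms bij_HomeoQ by blast
  have e: "f ` (f -` A) = A" using b by (simp add: bij_is_surj surj_image_vimage_eq)
  then have "clopen (f -` A)" using clopen_image_G[OF assms(2), of "f -` A"] A by simp
  then have "f -` A \<in> p \<or> - (f -` A) \<in> p" using assms unfolding clopen_ultrafilter_def by blast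
  moreover have "f ` (- (f -` A)) = - A" using b e by (simp add: bij_image_Compl_eq)
  ultimately show "A \<in> (`) f ` p \<or> - A \<in> (`) f ` p" using e by (metis imageI)
qed

text \<open>Only the behaviour on one member \<open>C\<close> matters: the image of \<open>X\<close>
  under \<open>f\<close> contains the image of \<open>X \<inter> C\<close> under \<open>g\<close>,
  which determines the image ultrafilter.\<close>

lemma ult_image_agree:
  assumes "clopen_ultrafilter p" "f \<in> G" "g \<in> G" "C \<in> p" "\<And>x. x \<in> C \<Longrightarrow> f x = g x"
  shows "(`) f ` p = (`) g ` p"
proof (rule ult_eq)
  show "clopen_ultrafilter ((`) f ` p)" "clopen_ultrafilter ((`) g ` p)" using assms ult_image by blast+
  show "(`) f ` p \<subseteq> (`) g ` p"
  proof clarify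
    fix X assume X: "X \<in> p"
    have "g ` (X \<inter> C) \<in> (`) g ` p" using ult_Int[OF assms(1) X assms(4)] by blast
    moreover have "g ` (X \<inter> C) \<subseteq> f ` X" using assms(5) by (metis Int_iff image_eqI image_subsetI)
    moreover have "clopen (f ` X)" using X assms clopen_image_G ult_clopen by blast
    ultimately show "f ` X \<in> (`) g ` p" by (rule ult_mono[OF \<open>clopen_ultrafilter ((`) g ` p)\<close>])
  qed
qed

lemma ult_stab_if_id:
  assumes "clopen_ultrafilter p" "f \<in> G" "C \<in> p" "\<And>x. x \<in> C \<Longrightarrow> f x = x"
  shows "f \<in> stab p"
  using ult_image_agree[OF assms(1,2) G_id assms(3)] assms by (simp add: stab_def)

lemma split_open:
  assumes "clopen U" "U \<noteq> {}"
  obtains V where "clopen V" "V \<subset> U" "V \<noteq> {}"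
proof -
  obtain x where x: "x \<in> U" using assms by blast
  then have "infinite U" using opq_infinite assms clopen_opq by blast
  then have "infinite (U - {x})" by simp
  then obtain y where y: "y \<in> U" "y \<noteq> x" by (metis Diff_iff finite.emptyI insertI1 ex_in_conv)
  obtain V where "clopen V" "x \<in> V" "V \<subseteq> U - {y}"
    using small_clopen[of U x "{y}"] assms clopen_opq x y by auto
  then show ?thesis using that y by blast
qed

text \<open>Split \<open>A\<close> into two nonempty clopen parts and exchange them. One part
  belongs to \<open>p\<close>, and its image is disjoint from it, so it cannot belong to
  \<open>p\<close> too.\<close>

lemma ult_moved:
  assumes "clopen_ultrafilter p" "A \<in> p"
  obtains s where "s \<in> G" "s \<notin> stab p" "\<And>x. x \<notin> A \<Longrightarrow> s x = x"
proof -
  have A: "clopen A" "A \<noteq> {}" using assms ult_clopen ult_meet3[of p A A A] by auto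
  obtain V where V: "clopen V" "V \<subset> A" "V \<noteq> {}" using split_open A by metis
  obtain s where s: "s \<in> G" "s ` V = A - V" "s ` (A - V) = V" "\<And>x. x \<notin> V \<Longrightarrow> x \<notin> A - V \<Longrightarrow> s x = x"
    by (rule swap_sets[of V "A - V"]) (use V A clopen_Diff in auto)
  have no: "\<not> (X \<in> p \<and> s ` X \<in> p)" if "X \<inter> s ` X = {}" for X
    using ult_meet3[OF assms(1), of X "s ` X" X] that by auto
  have "V \<in> p \<or> - V \<in> p" using V assms clopen_ultrafilter_def by auto
  then have "V \<in> p \<or> A - V \<in> p" using assms ult_Int[of p A "- V"] by (auto simp: Diff_eq)
  moreover have "s ` X \<in> p" if "s \<in> stab p" "X \<in> p" for X using that by (auto simp: stab_def)
  moreover have "V \<inter> s ` V = {}" "(A - V) \<inter> s ` (A - V) = {}" using s(2,3) by auto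
  ultimately have "s \<notin> stab p" using no by blast
  moreover have "s x = x" if "x \<notin> A" for x using s(4) that V by blast
  ultimately show ?thesis using that s(1) by blast
qed

text \<open>Let \<open>h\<close> and \<open>f\<close> carry \<open>p\<close> to \<open>q\<close> and
  \<open>r\<close>. If \<open>r\<close> differs from \<open>p\<close> and \<open>q\<close>, some
  \<open>s\<close> in the stabilizer carries \<open>r\<close> to \<open>q\<close>; then
  \<open>s \<circ> f\<close> carries \<open>p\<close> to \<open>q\<close>, just as \<open>h\<close>
  does, and so lies in \<open>H\<close>.\<close>

lemma ult_stab_maximal:
  assumes p: "clopen_ultrafilter p" shows "maximal_subgroup (stab p) HomeoQ"
proof (rule maximal_subgroupI[OF stab_subgroup])
  have "UNIV \<in> p" using p clopen_UNIV ult_meet3[of p "{}" "{}" "{}"] unfolding clopen_ultrafilter_def by (metis Compl_UNIV_eq Int_empty_left)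
  then show "stab p \<noteq> G" using ult_moved[OF p] by metis
next
  fix H h f assume H: "subgroup H HomeoQ" "stab p \<subseteq> H" "h \<in> H" "h \<notin> stab p" and f: "f \<in> G"
  have h: "h \<in> G" using H sub_G by blast
  define q where "q = (`) h ` p"
  define r where "r = (`) f ` p"
  have u: "clopen_ultrafilter q" "clopen_ultrafilter r" using p h f ult_image by (auto simp: q_def r_def)
  have "p \<noteq> q" using H h by (auto simp: q_def stab_def)
  \<comment> \<open>Such a \<open>g\<close> differs from \<open>h\<close> only by an element of the
    stabilizer of \<open>p\<close>.\<close>
  have reduce: "g \<in> H" if g: "g \<in> G" "(`) g ` p = q" for g
  proof -
    have "(`) (Hilbert_Choice.inv h \<circ> g) ` p = p"
      unfolding image_image_comp g(2) q_def by (rule image_image_inv) (use h bij_HomeoQ in blast)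
    then have "Hilbert_Choice.inv h \<circ> g \<in> stab p" using g h G_comp G_inv by (simp add: stab_def)
    then show ?thesis using H sub_cancel_left sub_inv by blast
  qed
  show "f \<in> H"
  proof (cases "r = p \<or> r = q")
    case True
    then show ?thesis using reduce f H by (auto simp: r_def stab_def)
  next
    case False
    obtain A1 where A1: "clopen A1" "A1 \<in> p" "- A1 \<in> q" using ult_separate p u \<open>p \<noteq> q\<close> by metis
    obtain A2 where A2: "clopen A2" "A2 \<in> p" "- A2 \<in> r" using ult_separate p u False by metis
    obtain B where B: "clopen B" "B \<in> q" "- B \<in> r" using ult_separate u False by metis
    define g where "g = h \<circ> Hilbert_Choice.inv f"
    have g: "g \<in> G" using h f G_comp G_inv by (simp add: g_def)
    have gr: "(`) g ` r = q"
      unfolding g_def image_image_comp r_def q_def using image_image_inv[of f p] f bij_HomeoQ by simp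
    have bA: "B \<inter> - A1 \<in> q" using ult_Int u A1 B by blast
    then have "B \<inter> - A1 \<in> (`) g ` r" using gr by simp
    then obtain Z where Z: "Z \<in> r" "g ` Z = B \<inter> - A1" by blast
    \<comment> \<open>\<open>Y\<close> is a member of \<open>r\<close> outside \<open>A2\<close> and
      \<open>B\<close>, and \<open>g\<close> moves it into \<open>B\<close> outside
      \<open>A1\<close>. So \<open>Y\<close> and its image are disjoint, and swapping them fixes
      \<open>A1 \<inter> A2\<close>, a member of \<open>p\<close>, pointwise.\<close>
    define Y where "Y = Z \<inter> - A2 \<inter> - B"
    have Y: "Y \<in> r" "clopen Y" "g ` Y \<subseteq> B \<inter> - A1" "Y \<inter> A2 = {}" "Y \<inter> B = {}"
    proof -
      show "Y \<in> r" unfolding Y_def using ult_Int[OF u(2) ult_Int[OF u(2) Z(1) A2(3)] B(3)] .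
      then show "clopen Y" using ult_clopen u by blast
      have "Y \<subseteq> Z" by (auto simp: Y_def)
      then show "g ` Y \<subseteq> B \<inter> - A1" using Z(2) by blast
    qed (auto simp: Y_def)
    have gY: "clopen (g ` Y)" using Y g clopen_image_G by blast
    have disj: "Y \<inter> g ` Y = {}" using Y by blast
    have ph: "homeo_betw Y (g ` Y) g" using g G_iff_homeo_betw homeo_betw_restrict by blast
    obtain s where s: "s \<in> G" "\<And>x. x \<in> Y \<Longrightarrow> s x = g x" "\<And>x. x \<notin> Y \<Longrightarrow> x \<notin> g ` Y \<Longrightarrow> s x = x"
      using swap[OF Y(2) gY disj ph] by metis
    have "A1 \<inter> A2 \<in> p" using ult_Int A1 A2 p by blast
    then have "s \<in> stab p" by (rule ult_stab_if_id[OF p s(1)]) (use s Y in blast)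
    then have sH: "s \<in> H" using H(2) by blast
    have "(`) s ` r = q" using ult_image_agree[OF u(2) s(1) g Y(1)] s gr by simp
    then have "(`) (s \<circ> f) ` p = q" by (simp only: image_image_comp r_def)
    then have "s \<circ> f \<in> H" by (rule reduce[OF G_comp[OF f s(1)]])
    then show ?thesis by (rule sub_cancel_left[OF H(1) sH])
  qed
qed

text \<open>If \<open>A\<close> separates \<open>p\<close> from \<open>q\<close>, a homeomorphism
  supported in \<open>- A\<close> can move \<open>q\<close>, while it fixes \<open>p\<close> because
  it is the identity on \<open>A\<close>.\<close>

lemma ult_stab_inj:
  assumes "clopen_ultrafilter p" "clopen_ultrafilter q" "stab p = stab q" shows "p = q"
proof (rule ccontr)
  assume "p \<noteq> q"
  then obtain A where A: "A \<in> p" "- A \<in> q" using ult_separate assms by metis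
  obtain s where s: "s \<in> G" "s \<notin> stab q" "\<And>x. x \<notin> - A \<Longrightarrow> s x = x"
    using ult_moved[OF assms(2) A(2)] by metis
  then have "s \<in> stab p" using ult_stab_if_id[OF assms(1) _ A(1)] by simp
  then show False using assms s by simp
qed

text \<open>Zorn's lemma gives a maximal family with the finite intersection property. If it decided
  neither \<open>A\<close> nor \<open>- A\<close>, finitely many members would avoid
  \<open>A\<close> and finitely many would avoid \<open>- A\<close>, leaving an empty
  intersection.\<close>

lemma ult_extension:
  assumes "\<And>A. A \<in> E \<Longrightarrow> clopen A" "\<And>S. S \<subseteq> E \<Longrightarrow> finite S \<Longrightarrow> \<Inter>S \<noteq> {}"
  obtains p where "clopen_ultrafilter p" "E \<subseteq> p"
proof -
  define fip where "fip P \<longleftrightarrow> (\<forall>S\<subseteq>P. finite S \<longrightarrow> \<Inter>S \<noteq> {})" for P :: "rat set set"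
  let ?F = "{P. E \<subseteq> P \<and> (\<forall>A\<in>P. clopen A) \<and> fip P}"
  have "\<exists>M\<in>?F. \<forall>X\<in>?F. M \<subseteq> X \<longrightarrow> X = M"
  proof (rule subset_Zorn_nonempty)
    show "?F \<noteq> {}" using assms by (auto simp: fip_def)
    fix C assume C: "C \<noteq> {}" "subset.chain ?F C"
    have "fip (\<Union>C)" unfolding fip_def
    proof (intro allI impI)
      fix S assume S: "S \<subseteq> \<Union>C" "finite S"
      obtain P where "P \<in> C" "S \<subseteq> P" using finite_subset_Union_chain[OF S(2,1) C] by blast
      then show "\<Inter>S \<noteq> {}" using C S(2) unfolding subset.chain_def fip_def by blast
    qed
    then show "\<Union>C \<in> ?F" using C unfolding subset.chain_def by blast
  qed
  then obtain p where "p \<in> ?F" and max': "\<forall>X\<in>?F. p \<subseteq> X \<longrightarrow> X = p" by (rule bexE)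
  then have p: "E \<subseteq> p" "\<forall>A\<in>p. clopen A" "fip p" by simp_all
  have max: "X = p" if "E \<subseteq> X" "\<forall>A\<in>X. clopen A" "fip X" "p \<subseteq> X" for X
    using max' that by simp
  have ins: "\<exists>S\<subseteq>p. finite S \<and> A \<inter> \<Inter>S = {}" if "clopen A" "A \<notin> p" for A
  proof -
    have "insert A p \<noteq> p" using that by blast
    then have "\<not> fip (insert A p)" using max[of "insert A p"] that(1) p by blast
    then obtain S where S: "S \<subseteq> insert A p" "finite S" "\<Inter>S = {}" unfolding fip_def by blast
    then have "S - {A} \<subseteq> p" "finite (S - {A})" "A \<inter> \<Inter>(S - {A}) = {}" by auto
    then show ?thesis by blast
  qed
  have "A \<in> p \<or> - A \<in> p" if A: "clopen A" for A
  proof (rule ccontr)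
    assume "\<not> (A \<in> p \<or> - A \<in> p)"
    then obtain S T where "S \<subseteq> p" "finite S" "A \<inter> \<Inter>S = {}" "T \<subseteq> p" "finite T" "- A \<inter> \<Inter>T = {}"
      using ins[OF A] ins[of "- A"] A by auto
    then have "S \<union> T \<subseteq> p" "finite (S \<union> T)" "\<Inter>(S \<union> T) = {}" by blast+
    then show False using p unfolding fip_def by blast
  qed
  then have "clopen_ultrafilter p" using p unfolding clopen_ultrafilter_def fip_def by blast
  then show ?thesis using that p by blast
qed

text \<open>An independent family of continuum many sets, living on the countable type of pairs
  (length, list of words): the \<open>X\<close>-th set contains \<open>(n, L)\<close> if the initial segment of length
  \<open>n\<close> of the characteristic function of \<open>X\<close> occurs in \<open>L\<close>.\<close>

definition indep :: "nat set \<Rightarrow> (nat \<times> bool list list) set" where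
  "indep X = {(n, L). map (\<lambda>i. i \<in> X) [0..<n] \<in> set L}"

text \<open>Take \<open>n\<close> so large that the initial segments of length \<open>n\<close>
  distinguish the finitely many sets, and let \<open>L\<close> list the segments of those that lie
  in \<open>\<F>\<close>.\<close>

lemma indep_finite:
  assumes "finite \<X>"
  obtains k where "\<And>X. X \<in> \<X> \<Longrightarrow> k \<in> indep X \<longleftrightarrow> X \<in> \<F>"
proof -
  have "\<exists>n. \<forall>X\<in>\<X>. \<forall>Y\<in>\<X>. X \<noteq> Y \<longrightarrow> (\<exists>i<n. i \<in> X \<longleftrightarrow> i \<notin> Y)"
  proof -
    define d where "d X Y = (LEAST i. i \<in> X \<longleftrightarrow> i \<notin> Y)" for X Y :: "nat set"
    have d: "d X Y \<in> X \<longleftrightarrow> d X Y \<notin> Y" if "X \<noteq> Y" for X Y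
      unfolding d_def using that by (intro LeastI_ex[of "\<lambda>i. i \<in> X \<longleftrightarrow> i \<notin> Y"]) blast
    have fin: "finite ((\<lambda>(X,Y). d X Y) ` (\<X> \<times> \<X>))" using assms by simp
    have lt: "d X Y < Suc (Max ((\<lambda>(X,Y). d X Y) ` (\<X> \<times> \<X>)))" if "X \<in> \<X>" "Y \<in> \<X>" for X Y
      using that by (intro le_imp_less_Suc Max_ge[OF fin]) force
    show ?thesis
    proof (rule exI, intro ballI impI)
      fix X Y assume "X \<in> \<X>" "Y \<in> \<X>" "X \<noteq> Y"
      then show "\<exists>i<Suc (Max ((\<lambda>(X,Y). d X Y) ` (\<X> \<times> \<X>))). i \<in> X \<longleftrightarrow> i \<notin> Y"
        using lt d by (intro exI[of _ "d X Y"] conjI) simp_all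
    qed
  qed
  then obtain n where n: "\<forall>X\<in>\<X>. \<forall>Y\<in>\<X>. X \<noteq> Y \<longrightarrow> (\<exists>i<n. i \<in> X \<longleftrightarrow> i \<notin> Y)" by (rule exE)
  define w where "w X = map (\<lambda>i. i \<in> X) [0..<n]" for X
  have w: "X = Y" if "X \<in> \<X>" "Y \<in> \<X>" and eq: "w X = w Y" for X Y
  proof (rule ccontr)
    assume "X \<noteq> Y"
    then have "\<exists>i<n. i \<in> X \<longleftrightarrow> i \<notin> Y" using n that(1,2) by simp
    then obtain i where i: "i < n" "i \<in> X \<longleftrightarrow> i \<notin> Y" by (elim exE conjE)
    have "w X ! i = w Y ! i" using eq by simp
    then show False using i by (simp add: w_def)
  qed
  obtain L where L: "set L = w ` (\<X> \<inter> \<F>)" using assms finite_list[of "w ` (\<X> \<inter> \<F>)"] by auto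
  have "(n, L) \<in> indep X \<longleftrightarrow> X \<in> \<F>" if "X \<in> \<X>" for X
  proof -
    have "(n, L) \<in> indep X \<longleftrightarrow> w X \<in> w ` (\<X> \<inter> \<F>)" by (simp add: indep_def L w_def)
    then show ?thesis using w that by blast
  qed
  then show ?thesis using that by blast
qed

text \<open>The countable index type is coded by the unit intervals of \<open>clopen_floor\<close>.
  On negative \<open>m\<close> the function \<open>nat\<close> merely repeats the code 0.\<close>

definition indep_clopen :: "nat set \<Rightarrow> rat set" where
  "indep_clopen X = {x. \<lfloor>real_of_rat x + sqrt 2\<rfloor> \<in> {m. from_nat (nat m) \<in> indep X}}"

lemma floor_sqrt2: "\<lfloor>real_of_rat (of_int m) + sqrt 2\<rfloor> = m + 1"
  by (rule floor_unique) (use sqrt2_less_2 in simp_all)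

text \<open>Each sign pattern \<open>\<F>\<close> has the finite intersection property by
  independence, so it extends to an ultrafilter. The pattern can be read off the ultrafilter, and
  the ultrafilter is determined by its stabilizer.\<close>

lemma many_maximal: "(UNIV :: nat set set set) \<lesssim> {M. maximal_subgroup M HomeoQ}"
proof -
  define E where "E \<F> = indep_clopen ` \<F> \<union> (\<lambda>X. - indep_clopen X) ` (- \<F>)" for \<F>
  have cl: "clopen (indep_clopen X)" for X unfolding indep_clopen_def by (rule clopen_floor)
  have "\<exists>p. clopen_ultrafilter p \<and> E \<F> \<subseteq> p" for \<F>
  proof -
    have "\<Inter>S \<noteq> {}" if S: "S \<subseteq> E \<F>" "finite S" for S
    proof -
      let ?c = "\<lambda>X. if X \<in> \<F> then indep_clopen X else - indep_clopen X"
      have "S \<subseteq> range ?c" using S unfolding E_def by auto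
      then obtain \<X> where X: "finite \<X>" "S = ?c ` \<X>" using S(2) by (meson finite_subset_image)
      obtain k where k: "\<And>X. X \<in> \<X> \<Longrightarrow> k \<in> indep X \<longleftrightarrow> X \<in> \<F>" using indep_finite X by metis
      \<comment> \<open>Subtracting 1 cancels the shift in \<open>floor_sqrt2\<close>, so the floor
        at \<open>x\<close> is the code of \<open>k\<close>.\<close>
      define x where "x = rat_of_int (int (to_nat k) - 1)"
      have "x \<in> indep_clopen X \<longleftrightarrow> k \<in> indep X" for X
        unfolding indep_clopen_def x_def mem_Collect_eq floor_sqrt2 by simp
      then have "x \<in> \<Inter>S" using k X by auto
      then show ?thesis by blast
    qed
    moreover have "clopen A" if "A \<in> E \<F>" for A using that cl unfolding E_def by auto
    ultimately show ?thesis using ult_extension[of "E \<F>"] by metis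
  qed
  then obtain u where u: "\<And>\<F>. clopen_ultrafilter (u \<F>)" "\<And>\<F>. E \<F> \<subseteq> u \<F>" by metis
  have "inj (\<lambda>\<F>. stab (u \<F>))"
  proof (rule injI)
    fix \<F> \<F>' assume "stab (u \<F>) = stab (u \<F>')"
    then have e: "u \<F> = u \<F>'" using ult_stab_inj u by blast
    have "X \<in> \<F> \<longleftrightarrow> indep_clopen X \<in> u \<F>" for X \<F>
      using u[of \<F>] ult_Compl[OF u(1)[of \<F>] cl[of X]] unfolding E_def by blast
    then show "\<F> = \<F>'" using e by blast
  qed
  moreover have "range (\<lambda>\<F>. stab (u \<F>)) \<subseteq> {M. maximal_subgroup M HomeoQ}" using u ult_stab_maximal by blast
  ultimately show ?thesis unfolding lepoll_def by blast
qed

text \<open>A map is coded by its graph, a set of naturals, and hence a set of maps by a set of sets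
  of naturals.\<close>

lemma maximal_upper: "{M. maximal_subgroup M HomeoQ} \<lesssim> (UNIV :: nat set set set)"
proof -
  define g where "g f = {to_nat (x, f x) |x. True}" for f :: "rat \<Rightarrow> rat"
  have "inj g"
  proof (rule injI, rule ext)
    fix f f' x assume "g f = g f'"
    moreover have "to_nat (x, f x) \<in> g f" by (auto simp: g_def)
    ultimately have "to_nat (x, f x) \<in> g f'" by simp
    then obtain y where "to_nat (x, f x) = to_nat (y, f' y)" by (auto simp: g_def)
    then show "f x = f' x" by (metis Pair_inject from_nat_to_nat)
  qed
  then have "inj ((`) g)" by (auto simp: inj_on_def inj_image_eq_iff)
  then show ?thesis unfolding lepoll_def by (metis subset_UNIV inj_on_subset)
qed

section \<open>Open maximal subgroups\<close>

text \<open>Finite intersections of the generating sets prescribe values at finitely many points.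
  This form serves for open and closed subgroups alike.\<close>

lemma openin_pointwise_iff:
  "openin pointwise_topology S \<longleftrightarrow>
     S \<subseteq> G \<and> (\<forall>f\<in>S. \<exists>F. finite F \<and> {g \<in> G. \<forall>x\<in>F. g x = f x} \<subseteq> S)"
proof
  assume S: "openin pointwise_topology S"
  then have "generate_topology_on {basic_nbhd x y |x y. True} S"
    by (simp add: pointwise_topology_def openin_topology_generated_by)
  then have "\<forall>f\<in>S. \<exists>F. finite F \<and> {g \<in> G. \<forall>x\<in>F. g x = f x} \<subseteq> S"
  proof induction
    case (Int a b)
    show ?case
    proof
      fix f assume "f \<in> a \<inter> b"
      then obtain F F' where "finite F" "{g \<in> G. \<forall>x\<in>F. g x = f x} \<subseteq> a"
        "finite F'" "{g \<in> G. \<forall>x\<in>F'. g x = f x} \<subseteq> b" using Int.IH by (meson IntD1 IntD2)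
      then show "\<exists>F. finite F \<and> {g \<in> G. \<forall>x\<in>F. g x = f x} \<subseteq> a \<inter> b"
        by (intro exI[of _ "F \<union> F'"]) auto
    qed
  next
    case (UN K) then show ?case by (meson Union_iff Sup_upper order_trans)
  next
    case (Basis s)
    then obtain x y where s: "s = basic_nbhd x y" by auto
    show ?case
    proof
      fix f assume "f \<in> s"
      then show "\<exists>F. finite F \<and> {g \<in> G. \<forall>x\<in>F. g x = f x} \<subseteq> s"
        by (intro exI[of _ "{x}"]) (auto simp: s basic_nbhd_def)
    qed
  qed simp
  moreover have "S \<subseteq> G" using openin_subset[OF S] by simp
  ultimately show "S \<subseteq> G \<and> (\<forall>f\<in>S. \<exists>F. finite F \<and> {g \<in> G. \<forall>x\<in>F. g x = f x} \<subseteq> S)" by simp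
next
  assume S: "S \<subseteq> G \<and> (\<forall>f\<in>S. \<exists>F. finite F \<and> {g \<in> G. \<forall>x\<in>F. g x = f x} \<subseteq> S)"
  have op: "openin pointwise_topology {g \<in> G. \<forall>x\<in>F. g x = f x}" if "finite F" for F f
    using that
  proof induction
    case empty
    then show ?case using openin_topspace[of pointwise_topology] by simp
  next
    case (insert x F)
    have "{g \<in> G. \<forall>x\<in>insert x F. g x = f x} = basic_nbhd x (f x) \<inter> {g \<in> G. \<forall>x\<in>F. g x = f x}"
      by (auto simp: basic_nbhd_def)
    then show ?case using openin_Int[OF openin_basic_nbhd insert.IH] by simp
  qed
  show "openin pointwise_topology S"
  proof (subst openin_subopen, rule ballI)
    fix f assume f: "f \<in> S"
    then obtain F where "finite F" "{g \<in> G. \<forall>x\<in>F. g x = f x} \<subseteq> S" using S by blast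
    moreover have "f \<in> {g \<in> G. \<forall>x\<in>F. g x = f x}" using f S by blast
    ultimately show "\<exists>T. openin pointwise_topology T \<and> f \<in> T \<and> T \<subseteq> S" using op by blast
  qed
qed

text \<open>By induction on \<open>A\<close>: the image of one more point is corrected by a swap
  that fixes all values already prescribed.\<close>

lemma highly_transitive:
  assumes "finite A" "finite B" "inj_on f A" "A \<inter> B = {}" "f ` A \<inter> B = {}"
  obtains g where "g \<in> G" "\<And>a. a \<in> A \<Longrightarrow> g a = f a" "\<And>b. b \<in> B \<Longrightarrow> g b = b"
proof -
  have "\<exists>g\<in>G. (\<forall>a\<in>A. g a = f a) \<and> (\<forall>b\<in>B. g b = b)"
    using assms
  proof (induction rule: finite_induct)
    case empty
    then show ?case by (intro bexI[of _ id]) (auto simp: G_id)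
  next
    case (insert a A)
    then obtain g where g: "g \<in> G" "\<forall>a\<in>A. g a = f a" "\<forall>b\<in>B. g b = b" by auto
    have inj: "g x = g y \<longleftrightarrow> x = y" for x y using g(1) bij_HomeoQ bij_is_inj inj_eq by metis
    have ga: "g a \<notin> f ` A \<union> B"
    proof
      assume "g a \<in> f ` A \<union> B"
      then obtain b where "b \<in> A \<union> B" "g a = g b" using g(2,3) by (auto intro: that)
      then show False using inj insert by auto
    qed
    have fa: "f a \<notin> f ` A \<union> B" using insert by auto
    show ?case
    proof (cases "g a = f a")
      case True
      then show ?thesis using g by blast
    next
      case False
      obtain s where s: "s \<in> G" "s (g a) = f a" "\<And>z. z \<in> f ` A \<union> B \<Longrightarrow> s z = z"
        by (rule swap_points[OF False, of "f ` A \<union> B" UNIV])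
          (use insert ga fa clopen_opq[OF clopen_UNIV] in auto)
      then show ?thesis using g G_comp by (intro bexI[of _ "s \<circ> g"]) auto
    qed
  qed
  then show ?thesis using that by blast
qed

definition fixing :: "rat set \<Rightarrow> (rat \<Rightarrow> rat) set" where
  "fixing F = {g \<in> G. \<forall>x\<in>F. g x = x}"

text \<open>Multiplying \<open>f\<close> by \<open>k\<close> in \<open>fixing A\<close> and then by
  \<open>g\<close> in \<open>fixing B\<close> produces an element of \<open>fixing A\<close>. All
  the corrections lie in \<open>H\<close>, hence so does \<open>f\<close>.\<close>

lemma fixing_Int:
  assumes H: "subgroup H HomeoQ" and "finite A" "finite B" "fixing A \<subseteq> H" "fixing B \<subseteq> H"
  shows "fixing (A \<inter> B) \<subseteq> H"
proof
  fix f assume f: "f \<in> fixing (A \<inter> B)"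
  then have fG: "f \<in> G" and ffix: "\<And>x. x \<in> A \<Longrightarrow> x \<in> B \<Longrightarrow> f x = x" by (auto simp: fixing_def)
  have finj: "f x = f y \<longleftrightarrow> x = y" for x y using fG bij_HomeoQ bij_is_inj inj_eq by metis
  \<comment> \<open>\<open>k\<close> will fix \<open>A\<close> and push these points off
    \<open>A \<union> B\<close>, so that \<open>k \<circ> f\<close> takes no point of
    \<open>A - B\<close> into \<open>B\<close>.\<close>
  define Z where "Z = f ` A - A"
  have "infinite (- (A \<union> B))" using assms infinite_UNIV_char_0 by (metis finite_Un finite_compl)
  then have "Z \<lesssim> - (A \<union> B)" using assms by (intro finite_lepoll_infinite) (auto simp: Z_def)
  then obtain e where e: "inj_on e Z" "e ` Z \<subseteq> - (A \<union> B)" unfolding lepoll_def by blast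
  then have disj: "Z \<inter> A = {}" "e ` Z \<inter> A = {}" by (auto simp: Z_def)
  have "finite Z" using assms by (simp add: Z_def)
  obtain k where k: "k \<in> G" "\<And>z. z \<in> Z \<Longrightarrow> k z = e z" "\<And>a. a \<in> A \<Longrightarrow> k a = a"
    by (rule highly_transitive[of Z A e]) (use assms e disj \<open>finite Z\<close> in simp_all)
  define f1 where "f1 = k \<circ> f"
  have f1G: "f1 \<in> G" using k fG G_comp by (simp add: f1_def)
  then have binj: "inj f1" using bij_HomeoQ bij_is_inj by blast
  have f1AB: "f1 a = a" if "a \<in> A" "a \<in> B" for a using that ffix k by (simp add: f1_def)
  have f1B: "f1 a \<notin> B" if a: "a \<in> A" "a \<notin> B" for a
  proof (cases "f a \<in> A")
    case True
    \<comment> \<open>Otherwise \<open>f a\<close> lies in \<open>A \<inter> B\<close> and is fixed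
      by \<open>f\<close>, which forces \<open>a = f a\<close> and puts \<open>a\<close> in
      \<open>B\<close>.\<close>
    have "f a \<notin> B"
    proof
      assume "f a \<in> B"
      then have "f (f a) = f a" using True ffix by blast
      then show False using finj a \<open>f a \<in> B\<close> by simp
    qed
    then show ?thesis using True k by (simp add: f1_def)
  next
    case False
    then have "f a \<in> Z" using a by (simp add: Z_def)
    then show ?thesis using k e by (auto simp: f1_def)
  qed
  \<comment> \<open>\<open>g\<close> takes \<open>f1\<close> back to the identity on
    \<open>A - B\<close>; it may fix \<open>B\<close> because \<open>f1\<close> sends
    \<open>A - B\<close> outside \<open>B\<close>.\<close>
  obtain g where g: "g \<in> G" "\<And>y. y \<in> f1 ` (A - B) \<Longrightarrow> g y = inv_into UNIV f1 y" "\<And>b. b \<in> B \<Longrightarrow> g b = b"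
  proof (rule highly_transitive[of "f1 ` (A - B)" B "inv_into UNIV f1"])
    show "inj_on (inv_into UNIV f1) (f1 ` (A - B))" by (rule inj_on_inv_into) auto
    show "inv_into UNIV f1 ` f1 ` (A - B) \<inter> B = {}" using binj by (auto simp: image_image inv_f_f)
  qed (use assms f1B in auto)
  have "(g \<circ> f1) a = a" if "a \<in> A" for a
    using g(2)[of "f1 a"] g(3)[of a] f1AB[of a] that binj by (cases "a \<in> B") (auto simp: inv_f_f)
  then have "g \<circ> f1 \<in> H" using assms G_comp[OF f1G g(1)] by (auto simp: fixing_def)
  moreover have "g \<in> H" using g assms by (auto simp: fixing_def)
  ultimately have "f1 \<in> H" using sub_cancel_left H by blast
  moreover have "k \<in> H" using k assms by (auto simp: fixing_def)
  ultimately show "f \<in> H" using sub_cancel_left[OF H] unfolding f1_def by blast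
qed

text \<open>Conjugation by \<open>h\<close> turns elements fixing the image of \<open>F\<close> into
  elements fixing \<open>F\<close>.\<close>

lemma fixing_image:
  assumes H: "subgroup H HomeoQ" and "h \<in> H" "fixing F \<subseteq> H"
  shows "fixing (h ` F) \<subseteq> H"
proof
  fix g assume g: "g \<in> fixing (h ` F)"
  have h: "h \<in> G" "bij h" using assms sub_G bij_HomeoQ by blast+
  let ?c = "Hilbert_Choice.inv h \<circ> (g \<circ> h)"
  have "?c \<in> G" using g h G_comp G_inv by (simp add: fixing_def)
  moreover have "?c x = x" if "x \<in> F" for x
    using g h that by (simp add: fixing_def bij_is_inj inv_f_f)
  ultimately have "?c \<in> H" using assms by (auto simp: fixing_def)
  then have "g \<circ> h \<in> H" using sub_cancel_left[OF H sub_inv[OF H assms(2)]] by blast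
  then have "(g \<circ> h) \<circ> Hilbert_Choice.inv h \<in> H" using sub_comp[OF H sub_inv[OF H assms(2)]] by blast
  moreover have "(g \<circ> h) \<circ> Hilbert_Choice.inv h = g"
    using h by (simp add: fun_eq_iff bij_is_surj surj_f_inv_f)
  ultimately show "g \<in> H" by simp
qed

text \<open>For \<open>h\<close> in \<open>M\<close>, \<open>fixing_image\<close> and
  \<open>fixing_Int\<close> show that the intersection of \<open>F\<close> with its image under
  \<open>h\<close> also has its pointwise stabilizer in \<open>M\<close>. Minimality of
  \<open>F\<close> then forces \<open>h\<close> to preserve \<open>F\<close>.\<close>

lemma open_maximal_eq_stabilizer:
  assumes M: "maximal_subgroup M HomeoQ" and "openin pointwise_topology M"
  obtains F where "finite F" "M = {f \<in> G. f ` F = F}"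
proof -
  have sub: "subgroup M HomeoQ" and "M \<noteq> G" using M by (auto simp: maximal_subgroup_def)
  have "id \<in> M" using sub sub_id by blast
  then have ex: "\<exists>F. finite F \<and> fixing F \<subseteq> M" 
    using assms(2) unfolding openin_pointwise_iff fixing_def id_def by fastforce
  define F where "F = arg_min card (\<lambda>F. finite F \<and> fixing F \<subseteq> M)"
  have F: "finite F" "fixing F \<subseteq> M" and min: "\<And>E. finite E \<Longrightarrow> fixing E \<subseteq> M \<Longrightarrow> card F \<le> card E"
    using arg_min_nat_lemma[of "\<lambda>F. finite F \<and> fixing F \<subseteq> M" _ card] ex unfolding F_def by blast+
  define K where "K = {f \<in> G. f ` F = F}"
  \<comment> \<open>For empty \<open>F\<close>, \<open>fixing F\<close> would be the whole group.
    Nonemptiness later makes the setwise stabilizer proper.\<close>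
  have "F \<noteq> {}" using F \<open>M \<noteq> G\<close> sub_G[OF sub] by (auto simp: fixing_def)
  have "M \<subseteq> K"
  proof
    fix h assume h: "h \<in> M"
    have "fixing (F \<inter> h ` F) \<subseteq> M"
      by (rule fixing_Int[OF sub F(1) _ F(2) fixing_image[OF sub h F(2)]]) (use F in simp)
    then have "card F \<le> card (F \<inter> h ` F)" using min F by simp
    then have "F \<inter> h ` F = F" using F by (intro card_seteq) auto
    moreover have "card (h ` F) = card F" using h sub_G[OF sub] bij_HomeoQ bij_is_inj card_image inj_on_subset by (metis subsetD subset_UNIV)
    ultimately have "h ` F = F" using F by (metis Int_lower2 card_subset_eq finite_imageI)
    then show "h \<in> K" using h sub_G[OF sub] by (auto simp: K_def)
  qed
  moreover have "subgroup K HomeoQ"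
    unfolding subgroup_HomeoQ_iff
  proof (intro conjI ballI)
    fix f assume f: "f \<in> K"
    show "g \<circ> f \<in> K" if "g \<in> K" for g
      using f that G_comp by (simp add: K_def flip: image_image)
    have "Hilbert_Choice.inv f ` f ` F = F"
      using f bij_HomeoQ bij_is_inj image_inv_f_f by (metis (no_types, lifting) K_def mem_Collect_eq)
    then show "Hilbert_Choice.inv f \<in> K" using f G_inv by (simp add: K_def)
  qed (auto simp: K_def G_id)
  moreover have "K \<noteq> G"
  proof -
    obtain x where x: "x \<in> F" using \<open>F \<noteq> {}\<close> by blast
    obtain y where y: "y \<notin> F" using ex_new_if_finite[OF infinite_UNIV_char_0 F(1)] by blast
    obtain s where "s \<in> G" "s x = y"
      by (rule swap_points[of x y "{}" UNIV]) (use x y clopen_opq[OF clopen_UNIV] in auto)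
    then have "s \<in> G" "s \<notin> K" using x y by (auto simp: K_def)
    then show ?thesis by blast
  qed
  ultimately have "M = K" using maximal_subgroup_eq M by blast
  then show ?thesis using that F by (simp add: K_def)
qed

section \<open>Principal ultrafilters and point stabilizers\<close>

definition principal :: "rat \<Rightarrow> rat set set" where
  "principal x = {A. clopen A \<and> x \<in> A}"

lemma ult_principal: "clopen_ultrafilter (principal x)"
  unfolding clopen_ultrafilter_def
proof (intro conjI ballI allI impI)
  fix S assume "S \<subseteq> principal x"
  then have "x \<in> \<Inter>S" by (auto simp: principal_def)
  then show "\<Inter>S \<noteq> {}" by blast
qed (auto simp: principal_def)

lemma principal_eq: "principal x = principal y \<longleftrightarrow> x = y"
proof
  assume e: "principal x = principal y"
  show "x = y"
  proof (rule ccontr)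
    assume "x \<noteq> y"
    then obtain V where "clopen V" "x \<in> V" "V \<subseteq> UNIV - {y}"
      using small_clopen[of UNIV x "{y}"] clopen_opq[OF clopen_UNIV] by auto
    then show False using e unfolding principal_def by blast
  qed
qed simp

text \<open>A homeomorphism \<open>f\<close> carries the ultrafilter at \<open>x\<close> to the one
  at \<open>f x\<close>, and different points have different ultrafilters.\<close>

lemma stab_principal: "stab (principal x) = basic_nbhd x x"
proof -
  have "(`) f ` principal x = principal (f x)" if f: "f \<in> G" for f
  proof (rule ult_eq)
    show "(`) f ` principal x \<subseteq> principal (f x)"
      using clopen_image_G[OF f] by (auto simp: principal_def)
  qed (use f ult_principal ult_image in blast)+
  then have "f \<in> stab (principal x) \<longleftrightarrow> f \<in> basic_nbhd x x" for f
    by (cases "f \<in> G") (simp_all add: stab_def basic_nbhd_def principal_eq)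
  then show ?thesis by blast
qed

text \<open>There are only countably many finite sets \<open>F\<close> to stabilize, while the point
  stabilizers already form an infinite family.\<close>

lemma open_maximal_eqpoll:
  "{M. maximal_subgroup M HomeoQ \<and> openin pointwise_topology M} \<approx> (UNIV :: nat set)" (is "?O \<approx> _")
proof (rule lepoll_antisym)
  have "?O \<subseteq> (\<lambda>F. {f \<in> G. f ` F = F}) ` {F. finite F}"
  proof
    fix M assume "M \<in> ?O"
    then have M: "maximal_subgroup M HomeoQ" "openin pointwise_topology M" by simp_all
    obtain F where "finite F" "M = {f \<in> G. f ` F = F}"
      by (rule open_maximal_eq_stabilizer[OF M])
    then show "M \<in> (\<lambda>F. {f \<in> G. f ` F = F}) ` {F. finite F}" by simp
  qed
  moreover have "countable {F :: rat set. finite F}" by (rule countable_Collect_finite)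
  ultimately have "countable ?O" by (meson countable_image countable_subset)
  then show "?O \<lesssim> (UNIV :: nat set)" by (auto simp: countable_def lepoll_def)
  have "x = y" if "basic_nbhd x x = basic_nbhd y y" for x y
    using ult_stab_inj[OF ult_principal ult_principal, of x y] that
    by (simp add: stab_principal principal_eq)
  then have inj: "inj (\<lambda>x. basic_nbhd x x)" by (auto intro: injI)
  have "range (\<lambda>x. basic_nbhd x x) \<subseteq> ?O"
  proof clarify
    fix x
    show "maximal_subgroup (basic_nbhd x x) HomeoQ \<and> openin pointwise_topology (basic_nbhd x x)"
      using ult_stab_maximal[OF ult_principal, of x] openin_basic_nbhd by (simp add: stab_principal)
  qed
  moreover have "infinite (range (\<lambda>x. basic_nbhd x x))"
    using finite_imageD[OF _ inj] infinite_UNIV_char_0[where 'a = rat] by blast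
  ultimately have "infinite ?O" using finite_subset by blast
  then show "(UNIV :: nat set) \<lesssim> ?O" by (simp add: infinite_le_lepoll)
qed

section \<open>Closed maximal subgroups\<close>

definition supp :: "rat set \<Rightarrow> (rat \<Rightarrow> rat) set" where
  "supp C = {f \<in> G. \<forall>x. x \<notin> C \<longrightarrow> f x = x}"

lemma supp_mono: "C \<subseteq> D \<Longrightarrow> supp C \<subseteq> supp D"
  by (auto simp: supp_def)

lemma supp_comp: "f \<in> supp C \<Longrightarrow> g \<in> supp C \<Longrightarrow> g \<circ> f \<in> supp C"
  by (simp add: supp_def G_comp)

lemma supp_image: "f \<in> supp C \<Longrightarrow> C \<subseteq> D \<Longrightarrow> f ` D = D"
proof -
  assume f: "f \<in> supp C" and "C \<subseteq> D"
  then have "f ` (- D) = (\<lambda>x. x) ` (- D)" by (intro image_cong) (auto simp: supp_def)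
  moreover have "bij f" using f bij_HomeoQ by (simp add: supp_def)
  ultimately have "- f ` D = - D" by (simp add: bij_image_Compl_eq)
  then show ?thesis by simp
qed

lemma restrict_homeo:
  assumes "m \<in> G" "clopen P" "m ` P = P"
  obtains k where "k \<in> supp P" "\<And>x. x \<in> P \<Longrightarrow> k x = m x"
proof -
  have ph: "homeo_betw P P m" using homeo_betw_restrict[of UNIV UNIV m P] assms by (simp add: G_iff_homeo_betw)
  have o: "opq P" "opq (- P)" "opq {}" using assms clopen_opq clopen_Compl clopen_empty by auto
  obtain k where k: "k \<in> G" "\<And>x. x \<in> P \<Longrightarrow> k x = m x" "\<And>x. x \<in> - P \<Longrightarrow> k x = x"
    by (rule glue3[OF ph homeo_betw_id[of "- P"] homeo_betw_id[of "{}"]]) (use o in auto)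
  have "k \<in> supp P" using k by (simp add: supp_def)
  then show ?thesis using that k by blast
qed

text \<open>As \<open>m\<close> preserves both \<open>P \<union> D\<close> and \<open>P\<close>, it
  preserves \<open>D\<close>, so its restrictions to \<open>P\<close> and \<open>D\<close> extend by
  the identity.\<close>

lemma supp_factor:
  assumes "clopen P" "clopen D" "P \<inter> D = {}" "m \<in> supp (P \<union> D)" "m ` P = P"
  obtains k l where "k \<in> supp P" "l \<in> supp D" "m = l \<circ> k"
proof -
  have mG: "m \<in> G" and mfix: "\<And>x. x \<notin> P \<union> D \<Longrightarrow> m x = x" using assms by (auto simp: supp_def)
  have "inj m" using mG bij_HomeoQ bij_is_inj by blast
  have "D = (P \<union> D) - P" using assms by blast
  then have "m ` D = m ` (P \<union> D) - m ` P"
    using image_set_diff[OF \<open>inj m\<close>, of "P \<union> D" P] by simp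
  then have mD: "m ` D = D" using supp_image[OF assms(4) subset_refl] assms(3,5) by auto
  obtain k where k: "k \<in> supp P" "\<And>x. x \<in> P \<Longrightarrow> k x = m x" using restrict_homeo mG assms by metis
  obtain l where l: "l \<in> supp D" "\<And>x. x \<in> D \<Longrightarrow> l x = m x" using restrict_homeo mG assms mD by metis
  have "m x = l (k x)" for x
  proof (cases "x \<in> P")
    case True
    then have "m x \<notin> D" using assms by blast
    then show ?thesis using True k l by (simp add: supp_def)
  next
    case False
    then have "k x = x" using k by (simp add: supp_def)
    then show ?thesis using False l mfix by (cases "x \<in> D") (auto simp: supp_def)
  qed
  then show ?thesis using that k l by (metis comp_apply ext)
qed

text \<open>The clopen sets \<open>T\<close> that the subgroup generated by the two supports can carry to \<open>C - D\<close>
  turn out to be all the nonempty proper clopen subsets of \<open>C \<union> D\<close>; correcting an arbitrary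
  element of the support of \<open>C \<union> D\<close> accordingly, it splits along \<open>C - D\<close> and \<open>D\<close>.\<close>

lemma supp_Un:
  assumes H: "subgroup H HomeoQ" and cl: "clopen C" "clopen D" and ne: "C \<inter> D \<noteq> {}"
    and HC: "supp C \<subseteq> H" and HD: "supp D \<subseteq> H"
  shows "supp (C \<union> D) \<subseteq> H"
proof (cases "C \<subseteq> D \<or> D \<subseteq> C")
  case True
  then show ?thesis using HC HD by (metis Un_absorb1 Un_absorb2)
next
  case False
  define P where "P = C - D"
  have P: "clopen P" "P \<noteq> {}" "P \<subset> C" using False ne cl clopen_Diff unfolding P_def by auto
  \<comment> \<open>\<open>R\<close> is a parking place, properly inside both \<open>C\<close> and
    \<open>D\<close>, into which parts of \<open>T\<close> or of its complement can be
    moved.\<close>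
  obtain R where R: "clopen R" "R \<subset> C \<inter> D" "R \<noteq> {}" using split_open clopen_Int cl ne by metis
  have RC: "R \<subset> C" "R \<subset> D" using R False by auto
  let ?W = "H \<inter> supp (C \<union> D)"
  have step: "\<exists>k\<in>?W. k ` T = P" if "k \<in> ?W" "\<exists>l\<in>?W. l ` k ` T = P" for k T
  proof -
    from that(2) obtain l where l: "l \<in> ?W" "l ` k ` T = P" by blast
    then have "l \<circ> k \<in> ?W" using that(1) supp_comp sub_comp[OF H] by blast
    moreover have "(l \<circ> k) ` T = P" using l by (simp add: image_comp)
    ultimately show ?thesis by blast
  qed
  have WC: "supp C \<subseteq> ?W" and WD: "supp D \<subseteq> ?W" using HC HD supp_mono[of C "C \<union> D"] supp_mono[of D "C \<union> D"] by auto
  have a: "\<exists>k\<in>?W. k ` T = P" if T: "clopen T" "T \<noteq> {}" "T \<subset> C" for T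
  proof -
    obtain k where "k \<in> G" "k ` T = P" "\<And>x. x \<notin> C \<Longrightarrow> k x = x"
      using move_within[OF cl(1) T(1) P(1) T(3) P(3) T(2) P(2)] by metis
    then show ?thesis using WC by (intro bexI[of _ k]) (auto simp: supp_def)
  qed
  \<comment> \<open>Squeezing \<open>T \<inter> D\<close> into \<open>R\<close> by a map supported
    in \<open>D\<close> brings \<open>T\<close> inside \<open>C\<close>. It stays proper there since
    it misses \<open>C \<inter> D - R\<close>, so \<open>a\<close> applies.\<close>
  have b: "\<exists>k\<in>?W. k ` T = P" if T: "clopen T" "T \<subseteq> C \<union> D" "T \<inter> D \<noteq> {}" "T \<inter> D \<noteq> D" for T
  proof -
    have TD: "T \<inter> D \<subset> D" using T by blast
    obtain k where k: "k \<in> G" "k ` (T \<inter> D) = R" "\<And>x. x \<notin> D \<Longrightarrow> k x = x"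
      using move_within[OF cl(2) clopen_Int[OF T(1) cl(2)] R(1) TD RC(2) T(3) R(3)] by metis
    have "k ` (T - D) = (\<lambda>x. x) ` (T - D)" using k by (intro image_cong) auto
    moreover have "k ` T = k ` (T \<inter> D) \<union> k ` (T - D)" by blast
    ultimately have kT: "k ` T = R \<union> (T - D)" using k by simp
    show ?thesis
    proof (rule step)
      show "k \<in> ?W" using k WD by (auto simp: supp_def)
      show "\<exists>l\<in>?W. l ` k ` T = P"
      proof (rule a)
        show "clopen (k ` T)" using T k clopen_image_G by blast
        show "k ` T \<noteq> {}" "k ` T \<subset> C" using kT R T by auto
      qed
    qed
  qed
  have ex: "\<exists>k\<in>?W. k ` T = P" if T: "clopen T" "T \<subset> C \<union> D" "T \<noteq> {}" for T
  proof -
    consider "T \<inter> D = {}" | "T \<inter> D \<noteq> {}" "T \<inter> D \<noteq> D" | "D \<subseteq> T" by blast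
    then show ?thesis
    proof cases
      case 1
      then show ?thesis using a[OF T(1,3)] T(2) ne by blast
    next
      case 2
      then show ?thesis using b T by blast
    next
      case 3
      \<comment> \<open>When \<open>T\<close> contains \<open>D\<close>, its complement lies in
        \<open>C\<close> and can be parked in \<open>R\<close>. The image of \<open>T\<close> then
        meets \<open>D\<close> exactly in \<open>D - R\<close>, which is the situation of
        \<open>b\<close>.\<close>
      let ?T = "(C \<union> D) - T"
      have T': "clopen ?T" "?T \<noteq> {}" "?T \<subset> C" using T 3 cl clopen_Diff clopen_Un ne by auto
      obtain k where k: "k \<in> G" "k ` ?T = R" "\<And>x. x \<notin> C \<Longrightarrow> k x = x"
        using move_within[OF cl(1) T'(1) R(1) T'(3) RC(1) T'(2) R(3)] by metis
      have kC: "k \<in> supp C" using k by (simp add: supp_def)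
      have "inj k" using k bij_HomeoQ bij_is_inj by blast
      have "T = (C \<union> D) - ?T" using T by blast
      then have "k ` T = k ` (C \<union> D) - k ` ?T" using image_set_diff[OF \<open>inj k\<close>] by metis
      then have kT: "k ` T = (C \<union> D) - R" using k supp_image[OF kC, of "C \<union> D"] by simp
      show ?thesis
      proof (rule step)
        show "k \<in> ?W" using kC WC by blast
        show "\<exists>l\<in>?W. l ` k ` T = P"
        proof (rule b)
          show "clopen (k ` T)" using T k clopen_image_G by blast
          show "k ` T \<subseteq> C \<union> D" "k ` T \<inter> D \<noteq> {}" "k ` T \<inter> D \<noteq> D" using kT R by auto
        qed
      qed
    qed
  qed
  show ?thesis
  proof
    fix f assume f: "f \<in> supp (C \<union> D)"
    then have fG: "f \<in> G" by (simp add: supp_def)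
    have "inj f" using fG bij_HomeoQ bij_is_inj by blast
    have "P \<subset> C \<union> D" using P by blast
    then have "f ` P \<subset> f ` (C \<union> D)" using \<open>inj f\<close> by (metis image_strict_mono inj_on_subset subset_UNIV)
    then have fP: "f ` P \<subset> C \<union> D" using supp_image[OF f] by simp
    have "clopen (f ` P)" "f ` P \<noteq> {}" using fG P clopen_image_G by auto
    \<comment> \<open>Undoing by \<open>k\<close> what \<open>f\<close> does to \<open>P\<close>
      gives an element preserving \<open>P\<close>, to which \<open>supp_factor\<close>
      applies.\<close>
    then obtain k where k: "k \<in> ?W" "k ` f ` P = P" using ex[OF _ fP] by blast
    have CD: "C \<union> D = P \<union> D" "P \<inter> D = {}" by (auto simp: P_def)
    have kf: "k \<circ> f \<in> supp (P \<union> D)" using supp_comp[OF f] k CD by simp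
    have "(k \<circ> f) ` P = P" using k by (simp add: image_comp)
    then obtain m l where "m \<in> supp P" "l \<in> supp D" "k \<circ> f = l \<circ> m"
      using supp_factor[OF P(1) cl(2) CD(2) kf] by metis
    moreover have "supp P \<subseteq> H" using HC supp_mono P by blast
    ultimately have "k \<circ> f \<in> H" using sub_comp[OF H] HD by auto
    then show "f \<in> H" using sub_cancel_left[OF H] k by blast
  qed
qed

text \<open>Conjugation by \<open>h\<close> turns homeomorphisms supported in the image of
  \<open>A\<close> into ones supported in \<open>A\<close>.\<close>

lemma supp_conj:
  assumes H: "subgroup H HomeoQ" and h: "h \<in> H" and A: "supp A \<subseteq> H"
  shows "supp (h ` A) \<subseteq> H"
proof
  fix g assume g: "g \<in> supp (h ` A)"
  have hG: "h \<in> G" "bij h" using H h sub_G bij_HomeoQ by blast+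
  let ?c = "Hilbert_Choice.inv h \<circ> (g \<circ> h)"
  have "?c \<in> G" using g hG G_comp G_inv by (simp add: supp_def)
  moreover have "?c x = x" if "x \<notin> A" for x
  proof -
    have "h x \<notin> h ` A" using that hG by (simp add: bij_is_inj inj_image_mem_iff)
    then show ?thesis using g hG by (simp add: supp_def bij_is_inj inv_f_f)
  qed
  ultimately have "?c \<in> H" using A by (auto simp: supp_def)
  then have "g \<circ> h \<in> H" using sub_cancel_left[OF H sub_inv[OF H h]] by blast
  then have "(g \<circ> h) \<circ> Hilbert_Choice.inv h \<in> H" using sub_comp[OF H sub_inv[OF H h]] by blast
  moreover have "(g \<circ> h) \<circ> Hilbert_Choice.inv h = g"
    using hG by (simp add: fun_eq_iff bij_is_surj surj_f_inv_f)
  ultimately show "g \<in> H" by simp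
qed

section \<open>Stabilizers of partitions into two clopen sets\<close>

lemma stab_pair_iff:
  assumes f: "f \<in> G"
  shows "f \<in> stab {A, - A} \<longleftrightarrow> f ` A = A \<or> f ` A = - A"
proof -
  have "f ` (- A) = - f ` A" using bij_HomeoQ[OF f] by (simp add: bij_image_Compl_eq)
  then have "f \<in> stab {A, - A} \<longleftrightarrow> {f ` A, - f ` A} = {A, - A}" using f by (simp add: stab_def)
  also have "\<dots> \<longleftrightarrow> f ` A = A \<or> f ` A = - A" by (auto simp: doubleton_eq_iff)
  finally show ?thesis .
qed

lemma supp_subset_stab: "supp A \<subseteq> stab {A, - A}"
  using supp_image[of _ A A] stab_pair_iff by (auto simp: supp_def)

text \<open>A set \<open>B\<close> that cuts neither block is a union of blocks, hence one of the
  four excluded sets.\<close>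

lemma exists_meeting:
  assumes "B \<noteq> {}" "B \<noteq> UNIV" "B \<noteq> A" "B \<noteq> - A"
  obtains P where "P = A \<or> P = - A" "P \<inter> B \<noteq> {}" "P - B \<noteq> {}"
proof -
  have "(A \<inter> B \<noteq> {} \<and> A - B \<noteq> {}) \<or> (- A \<inter> B \<noteq> {} \<and> - A - B \<noteq> {})"
    using assms by auto
  then show ?thesis using that by blast
qed

text \<open>Moving a point of \<open>P \<inter> B\<close> out of \<open>B\<close> prevents
  \<open>B\<close> from being preserved; fixing another point of \<open>P \<inter> B\<close>
  prevents it from being sent to \<open>- B\<close>.\<close>

lemma supp_not_stab:
  assumes "clopen P" "clopen B" "P \<inter> B \<noteq> {}" "P - B \<noteq> {}"
  obtains s where "s \<in> supp P" "s \<notin> stab {B, - B}"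
proof -
  obtain x y where xy: "x \<in> P \<inter> B" "y \<in> P - B" using assms by blast
  have "infinite (P \<inter> B)" using opq_infinite[of "P \<inter> B" x] clopen_opq clopen_Int assms xy by blast
  then have "infinite (P \<inter> B - {x})" by simp
  then obtain z where z: "z \<in> P \<inter> B - {x}" using infinite_imp_nonempty by blast
  obtain s where s: "s \<in> G" "s x = y" "\<And>w. w \<in> {z} \<Longrightarrow> s w = w" "\<And>w. w \<notin> P \<Longrightarrow> s w = w"
    by (rule swap_points[of x y "{z}" P]) (use xy z assms clopen_opq in auto)
  have "s ` B \<noteq> B" using s(2) xy by blast
  moreover have "s z = z" using s by simp
  then have "z \<in> s ` B" using z by force
  then have "s ` B \<noteq> - B" using z by blast
  ultimately have "s \<notin> stab {B, - B}" using stab_pair_iff[OF s(1)] by simp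
  moreover have "s \<in> supp P" using s by (simp add: supp_def)
  ultimately show ?thesis using that by blast
qed

text \<open>Conjugating by \<open>h\<close> puts the homeomorphisms supported in \<open>B\<close>
  and in \<open>- B\<close> into \<open>H\<close>. A block \<open>P\<close> cut by \<open>B\<close>
  overlaps both, so \<open>supp_Un\<close> applies to each, and then to the two unions, which share
  \<open>P\<close> and cover everything.\<close>

lemma stab_pair_maximal:
  assumes A: "clopen A" "A \<noteq> {}" "A \<noteq> UNIV"
  shows "maximal_subgroup (stab {A, - A}) HomeoQ"
proof (rule maximal_subgroupI[OF stab_subgroup])
  obtain s where "s \<in> supp UNIV" "s \<notin> stab {A, - A}"
    using supp_not_stab[of UNIV A] A by auto
  then show "stab {A, - A} \<noteq> G" by (auto simp: supp_def)
next
  fix H h f assume H: "subgroup H HomeoQ" and M: "stab {A, - A} \<subseteq> H" and h: "h \<in> H" "h \<notin> stab {A, - A}"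
    and f: "f \<in> G"
  have hG: "h \<in> G" "bij h" using H h sub_G bij_HomeoQ by blast+
  define B where "B = h ` A"
  have cB: "clopen B" using A hG clopen_image_G by (simp add: B_def)
  have hA: "h ` (- A) = - B" using hG by (simp add: bij_image_Compl_eq B_def)
  have "supp (- A) \<subseteq> stab {A, - A}" using supp_subset_stab[of "- A"] by (simp add: insert_commute)
  then have sA: "supp A \<subseteq> H" "supp (- A) \<subseteq> H" using M supp_subset_stab by blast+
  then have sB: "supp B \<subseteq> H" "supp (- B) \<subseteq> H"
    using supp_conj[OF H h(1)] unfolding B_def hA[unfolded B_def, symmetric] by blast+
  have "B \<noteq> {}" "B \<noteq> UNIV" using A hA by (auto simp: B_def)
  moreover have "B \<noteq> A" "B \<noteq> - A" using h(2) stab_pair_iff[OF hG(1)] by (auto simp: B_def)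
  ultimately obtain P where P: "P = A \<or> P = - A" "P \<inter> B \<noteq> {}" "P - B \<noteq> {}" by (rule exists_meeting)
  have cP: "clopen P" and sP: "supp P \<subseteq> H" using P A sA clopen_Compl by auto
  have "supp (P \<union> B) \<subseteq> H" by (rule supp_Un[OF H cP cB P(2) sP sB(1)])
  moreover have "P \<inter> - B \<noteq> {}" using P(3) by blast
  then have "supp (P \<union> - B) \<subseteq> H" using supp_Un[OF H cP clopen_Compl[OF cB] _ sP sB(2)] by blast
  moreover have "(P \<union> B) \<inter> (P \<union> - B) \<noteq> {}" using P by blast
  ultimately have "supp ((P \<union> B) \<union> (P \<union> - B)) \<subseteq> H"
    using supp_Un[OF H clopen_Un[OF cP cB] clopen_Un[OF cP clopen_Compl[OF cB]]] by blast
  moreover have "(P \<union> B) \<union> (P \<union> - B) = UNIV" by blast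
  ultimately show "f \<in> H" using f by (auto simp: supp_def)
qed

text \<open>If \<open>B\<close> cuts a block \<open>P\<close> of the other partition, some
  homeomorphism supported in \<open>P\<close> preserves \<open>{A, - A}\<close> but not
  \<open>{B, - B}\<close>.\<close>

lemma stab_pair_inj:
  assumes A: "clopen A" and B: "clopen B" "B \<noteq> {}" "B \<noteq> UNIV"
    and eq: "stab {A, - A} = stab {B, - B}"
  shows "A = B \<or> A = - B"
proof (rule ccontr)
  assume "\<not> (A = B \<or> A = - B)"
  then have "B \<noteq> A" "B \<noteq> - A" by auto
  then obtain P where P: "P = A \<or> P = - A" "P \<inter> B \<noteq> {}" "P - B \<noteq> {}" using exists_meeting B by metis
  have "clopen P" using P A clopen_Compl by auto
  then obtain s where s: "s \<in> supp P" "s \<notin> stab {B, - B}" using supp_not_stab P B by metis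
  have "supp P \<subseteq> stab {A, - A}"
    using P supp_subset_stab[of A] supp_subset_stab[of "- A"] by (auto simp: insert_commute)
  then show False using s eq by blast
qed

text \<open>One point witnesses that \<open>f\<close> does not preserve \<open>A\<close>, another
  that it does not send \<open>A\<close> to \<open>- A\<close>. Every \<open>g\<close> agreeing with
  \<open>f\<close> at both is outside as well.\<close>

lemma stab_pair_closed: "closedin pointwise_topology (stab {A, - A})"
proof -
  have "openin pointwise_topology (G - stab {A, - A})"
    unfolding openin_pointwise_iff
  proof (intro conjI ballI)
    fix f assume f: "f \<in> G - stab {A, - A}"
    then have ne: "f ` A \<noteq> A" "f ` A \<noteq> - A" using stab_pair_iff by auto
    have sf: "surj f" using f bij_HomeoQ bij_is_surj by blast
    have "\<exists>x. (x \<in> A) \<noteq> (f x \<in> A)"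
    proof (rule ccontr)
      assume "\<not> ?thesis"
      then have "A = f -` A" by auto
      then show False using ne(1) surj_image_vimage_eq[OF sf] by metis
    qed
    then obtain x where x: "(x \<in> A) \<noteq> (f x \<in> A)" by blast
    have "\<exists>y. (y \<in> A) = (f y \<in> A)"
    proof (rule ccontr)
      assume "\<not> ?thesis"
      then have "A = f -` (- A)" by auto
      then show False using ne(2) surj_image_vimage_eq[OF sf] by metis
    qed
    then obtain y where y: "(y \<in> A) = (f y \<in> A)" by blast
    have "g \<notin> stab {A, - A}" if g: "g \<in> G" "\<forall>w\<in>{x, y}. g w = f w" for g
    proof -
      have "inj g" using g bij_HomeoQ bij_is_inj by blast
      then have "g x \<in> g ` A \<longleftrightarrow> x \<in> A" "g y \<in> g ` A \<longleftrightarrow> y \<in> A" by (simp_all add: inj_image_mem_iff)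
      then have "g ` A \<noteq> A" "g ` A \<noteq> - A" using x y g by auto
      then show ?thesis using stab_pair_iff[OF g(1)] by simp
    qed
    then show "\<exists>F. finite F \<and> {g \<in> G. \<forall>w\<in>F. g w = f w} \<subseteq> G - stab {A, - A}"
      by (intro exI[of _ "{x, y}"]) auto
  qed simp
  moreover have "stab {A, - A} \<subseteq> G" by (auto simp: stab_def)
  ultimately show ?thesis by (simp add: closedin_def)
qed

text \<open>A closed set is determined by the basic open sets disjoint from it. These are given by
  finite lists of argument-value pairs, of which there are countably many.\<close>

lemma closed_upper: "{M. maximal_subgroup M HomeoQ \<and> closedin pointwise_topology M} \<lesssim> (UNIV :: nat set set)"
proof -
  define N where "N xs = {g \<in> G. \<forall>(x, y)\<in>set xs. g x = y}" for xs :: "(rat \<times> rat) list"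
  define c where "c M = {n. N (from_nat n) \<inter> M = {}}" for M
  have sub: "M \<subseteq> M'" if M: "closedin pointwise_topology M" "closedin pointwise_topology M'" and e: "c M = c M'" for M M'
  proof
    fix f assume f: "f \<in> M"
    show "f \<in> M'"
    proof (rule ccontr)
      assume "f \<notin> M'"
      have "f \<in> G" using closedin_subset[OF M(1)] f by auto
      have "openin pointwise_topology (G - M')" using M(2) by (simp add: closedin_def)
      then obtain F where F: "finite F" "{g \<in> G. \<forall>x\<in>F. g x = f x} \<subseteq> G - M'"
        using \<open>f \<in> G\<close> \<open>f \<notin> M'\<close> unfolding openin_pointwise_iff by blast
      obtain xs where xs: "set xs = (\<lambda>x. (x, f x)) ` F" using F finite_list[of "(\<lambda>x. (x, f x)) ` F"] by auto
      have N: "N xs = {g \<in> G. \<forall>x\<in>F. g x = f x}" by (auto simp: N_def xs)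
      then have "N xs \<inter> M' = {}" using F by blast
      then have "to_nat xs \<in> c M'" by (simp add: c_def)
      then have "to_nat xs \<in> c M" using e by simp
      then have "N xs \<inter> M = {}" by (simp add: c_def)
      then show False using f \<open>f \<in> G\<close> N by blast
    qed
  qed
  have "inj_on c {M. maximal_subgroup M HomeoQ \<and> closedin pointwise_topology M}"
    by (rule inj_onI) (use sub in \<open>auto intro!: equalityI\<close>)
  then show ?thesis unfolding lepoll_def by blast
qed

lemma closed_lower: "(UNIV :: nat set set) \<lesssim> {M. maximal_subgroup M HomeoQ \<and> closedin pointwise_topology M}"
proof -
  \<comment> \<open>By \<open>floor_sqrt2\<close> the integer \<open>m\<close> is tested at
    \<open>m + 1\<close>: \<open>-1\<close> is always in \<open>A S\<close>, \<open>-2\<close>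
    never, and the nonnegative integers encode \<open>S\<close>. The common point \<open>-1\<close>
    excludes that two such sets are complementary.\<close>
  define A where "A S = {x. \<lfloor>real_of_rat x + sqrt 2\<rfloor> \<in> {m. m = 0 \<or> m > 0 \<and> nat (m - 1) \<in> S}}" for S
  have cl: "clopen (A S)" for S unfolding A_def by (rule clopen_floor)
  have mem: "rat_of_int m \<in> A S \<longleftrightarrow> m = -1 \<or> m \<ge> 0 \<and> nat m \<in> S" for m S
    unfolding A_def mem_Collect_eq floor_sqrt2 by auto
  have ne: "A S \<noteq> {}" "A S \<noteq> UNIV" for S
    using mem[of "-1" S] mem[of "-2" S] by auto
  have "inj (\<lambda>S. stab {A S, - A S})"
  proof (rule injI)
    fix S T assume "stab {A S, - A S} = stab {A T, - A T}"
    then have "A S = A T \<or> A S = - A T" by (rule stab_pair_inj[OF cl cl ne])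
    moreover have "rat_of_int (-1) \<in> A S" "rat_of_int (-1) \<in> A T" unfolding mem by simp_all
    ultimately have e: "A S = A T" by blast
    have "n \<in> S \<longleftrightarrow> n \<in> T" for n using mem[of "int n" S] mem[of "int n" T] e by simp
    then show "S = T" by blast
  qed
  moreover have "range (\<lambda>S. stab {A S, - A S}) \<subseteq> {M. maximal_subgroup M HomeoQ \<and> closedin pointwise_topology M}"
    using stab_pair_maximal[OF cl ne] stab_pair_closed by blast
  ultimately show ?thesis unfolding lepoll_def by blast
qed

theorem theorem2p12:
  shows "{M. maximal_subgroup M HomeoQ \<and> openin pointwise_topology M} \<approx> (UNIV :: nat set)
    \<and> {M. maximal_subgroup M HomeoQ \<and> closedin pointwise_topology M} \<approx> (UNIV :: nat set set)
    \<and> {M. maximal_subgroup M HomeoQ} \<approx> (UNIV :: nat set set set)"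
  using open_maximal_eqpoll lepoll_antisym[OF closed_upper closed_lower]
    lepoll_antisym[OF maximal_upper many_maximal] by simp

end
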